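(* Let $G\subseteq \mathrm{GL}(n,\mathbb{R})$ be a linear Lie group and let $u:\mathbb{R}\to \mathrm{Lie}(G)$ be an admissible input for the system $$\dot X = X u,\qquad Y = X,\qquad X\in G .$$ Let $a_0>0$ and consider the direct observer $$\dot{\hat X} = Y u Y^{-1}\hat X - a_0 \hat X \log(Y^{-1}\hat X),$$ with left-invariant error $E_l := X^{-1}\hat X$. Then, for $E_l(0)\in B(I_n,1)$, the direct observer exponentially stabilizes $E_l = I_n$. Furthermore, suppose that $u$ is such that for every initial condition $X(0)\in G$ the corresponding solution $X(t)$ is bounded. Then for $\hat X(0)\in G$ sufficiently close to $X(0)$ (i.e. for every $X(0)\in G$ there is $\varepsilon>0$ such that the following holds whenever $\|\hat X(0)-X(0)\|<\varepsilon$), the estimate satisfies $\hat X(t)\in G$ for $t\ge 0$ and $\hat X(t)\to X(t)$ exponentially as $t\to\infty$.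
   Context: A linear Lie group $G$ is a closed subgroup of $\mathrm{GL}(n,\mathbb{R})$; its Lie algebra is $\mathrm{Lie}(G)=\{A\in\mathbb{R}^{n\times n} : \exp(tA)\in G \text{ for all } t\in\mathbb{R}\}$. $\|\cdot\|$ is the matrix norm induced by the Euclidean norm, $I_n$ is the identity matrix and $B(A,r)=\{X\in\mathbb{R}^{n\times n}:\|A-X\|<r\}$. For a real matrix $X$ with no eigenvalue in $(-\infty,0]$, $\log(X)$ is the principal logarithm: the unique real $A$ with $\exp(A)=X$ whose eigenvalues all lie in $\{z\in\mathbb{C}:-\pi<\mathrm{Im}(z)<\pi\}$; for $X\in B(I_n,1)$ it equals $\sum_{k\ge1}\frac{(-1)^{k+1}}{k}(X-I_n)^k$. An input $u$ is admissible if for every $X(0)\in G$ the solution of $\dot X = Xu$ is unique, continuously differentiable and exists for all time. "For $E_l(0)\in B(I_n,1)$ the observer exponentially stabilizes $E_l=I_n$" means that $I_n$ is a locally exponentially stable equilibrium of the resulting dynamics of $E_l$ and that every solution with $E_l(0)\in B(I_n,1)$ converges exponentially to $I_n$. A matrix-valued function $Z(t)$ converges exponentially to $W(t)$ as $t\to\infty$ if there are $m,\alpha>0$ with $\|Z(t)-W(t)\|\le m e^{-\alpha t}$ for all $t\ge 0$. *)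

theory Defs
  imports "HOL-Analysis.Analysis"
begin

section \<open>Matrices: induced norm, exponential, principal logarithm\<close>

text \<open>The matrix norm induced by the Euclidean norm. The type-class norm of a matrix is the
  Frobenius norm; the two induce the same topology.\<close>

definition matrix_norm :: "real^'n^'n \<Rightarrow> real" where
  "matrix_norm A = onorm ((*v) A)"

text \<open>The type-class multiplication on \<^typ>\<open>real^'n^'n\<close> is componentwise, so the generic \<open>^\<close> and
  \<^const>\<open>exp\<close> are not the matrix power and exponential.\<close>

definition matrix_pow :: "real^'n^'n \<Rightarrow> nat \<Rightarrow> real^'n^'n" where
  "matrix_pow A k = (((**) A) ^^ k) (mat 1)"

definition matrix_exp :: "real^'n^'n \<Rightarrow> real^'n^'n" where
  "matrix_exp A = (\<Sum>k. (1 / fact k) *\<^sub>R matrix_pow A k)"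

definition complex_eigenvalue :: "real^'n^'n \<Rightarrow> complex \<Rightarrow> bool" where
  "complex_eigenvalue A z \<longleftrightarrow>
     (\<exists>v::complex^'n. v \<noteq> 0 \<and> map_matrix complex_of_real A *v v = z *s v)"

definition log_domain :: "(real^'n^'n) set" where
  "log_domain = {X. \<forall>x\<le>0. \<not> complex_eigenvalue X (complex_of_real x)}"

text \<open>Meaningful on \<^const>\<open>log_domain\<close> only.\<close>

definition matrix_log :: "real^'n^'n \<Rightarrow> real^'n^'n" where
  "matrix_log X = (THE A. matrix_exp A = X \<and>
     (\<forall>z. complex_eigenvalue A z \<longrightarrow> - pi < Im z \<and> Im z < pi))"

section \<open>Linear Lie groups\<close>

definition linear_lie_group :: "(real^'n^'n) set \<Rightarrow> bool" where
  "linear_lie_group G \<longleftrightarrow>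
     G \<subseteq> {A. invertible A} \<and>
     mat 1 \<in> G \<and>
     (\<forall>A\<in>G. \<forall>B\<in>G. A ** B \<in> G) \<and>
     (\<forall>A\<in>G. matrix_inv A \<in> G) \<and>
     closedin (top_of_set {A. invertible A}) G"

definition lie_algebra :: "(real^'n^'n) set \<Rightarrow> (real^'n^'n) set" where
  "lie_algebra G = {A. \<forall>t::real. matrix_exp (t *\<^sub>R A) \<in> G}"

section \<open>The system and the observer\<close>

definition system_solution ::
  "(real^'n^'n) set \<Rightarrow> (real \<Rightarrow> real^'n^'n) \<Rightarrow> (real \<Rightarrow> real^'n^'n) \<Rightarrow> bool" where
  "system_solution G u X \<longleftrightarrow>
     (\<forall>t. X t \<in> G \<and> (X has_vector_derivative (X t ** u t)) (at t))"

definition admissible_input :: "(real^'n^'n) set \<Rightarrow> (real \<Rightarrow> real^'n^'n) \<Rightarrow> bool" where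
  "admissible_input G u \<longleftrightarrow>
     (\<forall>X0\<in>G. (\<exists>!X. system_solution G u X \<and> X 0 = X0) \<and>
              (\<forall>X. system_solution G u X \<and> X 0 = X0 \<longrightarrow> X C1_differentiable_on UNIV))"

definition left_error ::
  "(real \<Rightarrow> real^'n^'n) \<Rightarrow> (real \<Rightarrow> real^'n^'n) \<Rightarrow> real \<Rightarrow> real^'n^'n" where
  "left_error X Xh t = matrix_inv (X t) ** Xh t"

definition forward_interval :: "real \<Rightarrow> ereal \<Rightarrow> real set" where
  "forward_interval t0 T = {t. t0 \<le> t \<and> ereal t < T}"

text \<open>The observer with output \<open>Y = X\<close>. Its right-hand side is defined only where
  \<open>Y\<^sup>-\<^sup>1 Xh\<close> has a principal logarithm, so a solution has to stay in that set.\<close>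

definition observer_solution ::
  "real \<Rightarrow> (real \<Rightarrow> real^'n^'n) \<Rightarrow> (real \<Rightarrow> real^'n^'n) \<Rightarrow> real \<Rightarrow> ereal \<Rightarrow>
     (real \<Rightarrow> real^'n^'n) \<Rightarrow> bool" where
  "observer_solution a0 u Y t0 T Xh \<longleftrightarrow>
     ereal t0 < T \<and>
     (\<forall>t\<in>forward_interval t0 T.
        matrix_inv (Y t) ** Xh t \<in> log_domain \<and>
        (Xh has_vector_derivative
          (Y t ** u t ** matrix_inv (Y t) ** Xh t
            - a0 *\<^sub>R (Xh t ** matrix_log (matrix_inv (Y t) ** Xh t))))
          (at t within forward_interval t0 T))"

definition maximal_observer_solution ::
  "real \<Rightarrow> (real \<Rightarrow> real^'n^'n) \<Rightarrow> (real \<Rightarrow> real^'n^'n) \<Rightarrow> real \<Rightarrow> ereal \<Rightarrow>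
     (real \<Rightarrow> real^'n^'n) \<Rightarrow> bool" where
  "maximal_observer_solution a0 u Y t0 T Xh \<longleftrightarrow>
     observer_solution a0 u Y t0 T Xh \<and>
     \<not> (\<exists>T' Xh'. T < T' \<and> observer_solution a0 u Y t0 T' Xh' \<and>
          (\<forall>t\<in>forward_interval t0 T. Xh' t = Xh t))"

definition converges_exponentially ::
  "(real \<Rightarrow> real^'n^'n) \<Rightarrow> (real \<Rightarrow> real^'n^'n) \<Rightarrow> bool" where
  "converges_exponentially Z W \<longleftrightarrow>
     (\<exists>m>0. \<exists>\<alpha>>0. \<forall>t\<ge>0. matrix_norm (Z t - W t) \<le> m * exp (- \<alpha> * t))"

section \<open>Exponential stability of the error\<close>

text \<open>The error dynamics is the family of all \<open>left_error X Xh\<close>, where \<open>X\<close> solves the system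
  and \<open>Xh\<close> the observer driven by \<open>X\<close>. As the observer equation depends on time through \<open>u\<close>
  and \<open>X\<close>, stability is uniform in the initial time and in \<open>X\<close>.\<close>

definition error_equilibrium ::
  "(real^'n^'n) set \<Rightarrow> real \<Rightarrow> (real \<Rightarrow> real^'n^'n) \<Rightarrow> bool" where
  "error_equilibrium G a0 u \<longleftrightarrow>
     (\<forall>X t0 Xh. system_solution G u X \<longrightarrow> (\<forall>t\<ge>t0. left_error X Xh t = mat 1) \<longrightarrow>
        observer_solution a0 u X t0 \<infinity> Xh)"

definition error_locally_exponentially_stable ::
  "(real^'n^'n) set \<Rightarrow> real \<Rightarrow> (real \<Rightarrow> real^'n^'n) \<Rightarrow> bool" where
  "error_locally_exponentially_stable G a0 u \<longleftrightarrow>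
     (\<exists>\<delta>>0. \<exists>m>0. \<exists>\<alpha>>0. \<forall>X t0 Xh0.
        system_solution G u X \<longrightarrow>
        matrix_norm (matrix_inv (X t0) ** Xh0 - mat 1) < \<delta> \<longrightarrow>
          (\<exists>T Xh. maximal_observer_solution a0 u X t0 T Xh \<and> Xh t0 = Xh0) \<and>
          (\<forall>T Xh. maximal_observer_solution a0 u X t0 T Xh \<longrightarrow> Xh t0 = Xh0 \<longrightarrow>
             T = \<infinity> \<and>
             (\<forall>t\<ge>t0. matrix_norm (left_error X Xh t - mat 1)
                \<le> m * exp (- \<alpha> * (t - t0)) * matrix_norm (left_error X Xh t0 - mat 1))))"

definition error_converges_from_unit_ball ::
  "(real^'n^'n) set \<Rightarrow> real \<Rightarrow> (real \<Rightarrow> real^'n^'n) \<Rightarrow> bool" where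
  "error_converges_from_unit_ball G a0 u \<longleftrightarrow>
     (\<forall>X Xh0.
        system_solution G u X \<longrightarrow>
        matrix_norm (matrix_inv (X 0) ** Xh0 - mat 1) < 1 \<longrightarrow>
          (\<exists>T Xh. maximal_observer_solution a0 u X 0 T Xh \<and> Xh 0 = Xh0) \<and>
          (\<forall>T Xh. maximal_observer_solution a0 u X 0 T Xh \<longrightarrow> Xh 0 = Xh0 \<longrightarrow>
             T = \<infinity> \<and> converges_exponentially (left_error X Xh) (\<lambda>_. mat 1)))"

definition observer_exponentially_stabilizes ::
  "(real^'n^'n) set \<Rightarrow> real \<Rightarrow> (real \<Rightarrow> real^'n^'n) \<Rightarrow> bool" where
  "observer_exponentially_stabilizes G a0 u \<longleftrightarrow>
     error_equilibrium G a0 u \<and>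
     error_locally_exponentially_stable G a0 u \<and>
     error_converges_from_unit_ball G a0 u"

end

theory Submission
  imports Defs "HOL-Computational_Algebra.Fundamental_Theorem_Algebra"
begin

text \<open>
  The left-invariant error $E = X^{-1}\hat X$ satisfies the autonomous equation
  $\dot E = -a_0 E \log E$, in which the input has cancelled (\<open>error_dynamics\<close>). Because $\log E$
  commutes with $E$, this equation says $\frac{d}{dt}\log E = -a_0 \log E$, so the solution is
  explicit: $E(t) = \exp(e^{-a_0(t - t_0)} L)$ with $L = \log E(t_0)$. All claims are read off from
  this formula once three points are settled.

  First, the formula must not leave the set where the logarithm is under control. In terms of the
  initial error $E(t_0) = 1 + x$ with $\|x\| < 1$ it is the power $(1+x)^s$, $s = e^{-a_0(t-t_0)}
  \in (0,1]$. The binomial coefficients of exponents in $[0,1]$ alternate in sign, and so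
  $\|(1+x)^s - 1\| \le 1 - (1-\|x\|)^s$ (\<open>norm_exp_scaleR_log_series\<close>). The right-hand
  side is below $1$ and at most $-s \ln(1 - \|x\|)$: the error never leaves the unit ball and
  decays like $e^{-a_0(t-t_0)}$, uniformly in $t_0$ and $X$.

  Second, on the unit ball the principal logarithm, defined by its spectrum, has to be the
  logarithm series (\<open>principal_log_unique\<close>, \<open>matrix_log_eq\<close>). The series is locally Lipschitz,
  so the error equation has unique solutions (\<open>locally_lipschitz_ode_unique\<close>), and every
  maximal observer solution is the explicit one, defined for all time
  (\<open>maximal_observer_solution_from_unit_ball\<close>).

  Third, the estimate remains in the group when it starts in the group close to $X(0)$. This is
  the part of Cartan's closed subgroup theorem saying that group elements near the identity are
  exponentials of elements of the Lie algebra (\<open>log_series_mem_generators\<close>): then $E(t)$ lies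
  on a one-parameter subgroup, and $\hat X = XE$. If $X$ is bounded, convergence of
  $E$ to the identity is convergence of $\hat X$ to $X$.

  The analysis takes place in a Banach algebra; square matrices with the operator norm are made
  into one by a type copy, since the multiplication of the vector type is componentwise.
\<close>

section \<open>Logarithm and binomial series in a Banach algebra\<close>

definition log_series :: "'a::{real_normed_algebra_1,banach} \<Rightarrow> 'a" where
  "log_series x = (\<Sum>k. ((-1) ^ Suc k / real k) *\<^sub>R x ^ k)"

text \<open>The power $(1+x)^s$. It will turn out to equal $\exp(s \log(1+x))$, in a form whose
  coefficients have known signs.\<close>

definition binomial_series :: "real \<Rightarrow> 'a::{real_normed_algebra_1,banach} \<Rightarrow> 'a" where
  "binomial_series s x = (\<Sum>k. (s gchoose k) *\<^sub>R x ^ k)"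

lemma summable_norm_log_series:
  fixes x :: "'a::{real_normed_algebra_1,banach}"
  assumes "norm x < 1"
  shows "summable (\<lambda>k. norm (((-1) ^ Suc k / real k) *\<^sub>R x ^ k))"
proof (rule summable_comparison_test'[where N = 0])
  show "summable (\<lambda>k. norm x ^ k)" using assms by simp
  fix k :: nat
  have "1 / real k * norm (x ^ k) \<le> 1 * norm x ^ k"
    by (intro mult_mono norm_power_ineq) (auto simp: divide_simps)
  then show "norm (norm (((-1) ^ Suc k / real k) *\<^sub>R x ^ k)) \<le> norm x ^ k"
    by (simp add: power_abs)
qed

lemma log_series_0 [simp]: "log_series 0 = 0"
proof -
  have "(\<lambda>k. ((-1) ^ Suc k / real k) *\<^sub>R (0::'a) ^ k) = (\<lambda>_. 0)"
  proof
    show "((-1) ^ Suc k / real k) *\<^sub>R (0::'a) ^ k = 0" for k by (cases k) auto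
  qed
  then show ?thesis by (simp add: log_series_def)
qed

lemma log_series_sums:
  fixes x :: "'a::{real_normed_algebra_1,banach}"
  assumes "norm x < 1"
  shows "(\<lambda>k. ((-1) ^ Suc k / real k) *\<^sub>R x ^ k) sums log_series x"
  unfolding log_series_def
  by (rule summable_sums[OF summable_norm_cancel[OF summable_norm_log_series[OF assms]]])

lemma commute_log_series:
  fixes a x :: "'a::{real_normed_algebra_1,banach}"
  assumes "norm x < 1" "a * x = x * a"
  shows "a * log_series x = log_series x * a"
proof -
  have "a * x ^ k = x ^ k * a" for k
  proof (induction k)
    case (Suc k)
    have "a * x ^ Suc k = x * (a * x ^ k)" by (simp add: mult.assoc[symmetric] assms(2))
    then show ?case by (simp add: Suc mult.assoc)
  qed simp
  then have "(\<lambda>k. ((-1) ^ Suc k / real k) *\<^sub>R x ^ k * a) sums (a * log_series x)"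
    using sums_mult[OF log_series_sums[OF assms(1)], of a] by simp
  then show ?thesis
    using sums_mult2[OF log_series_sums[OF assms(1)], of a] by (rule sums_unique2)
qed

lemma norm_power_diff_le:
  fixes x y :: "'a::real_normed_algebra_1"
  assumes "norm x \<le> r" "norm y \<le> r"
  shows "norm (x ^ Suc k - y ^ Suc k) \<le> real (Suc k) * r ^ k * norm (x - y)"
proof (induction k)
  case 0 then show ?case by simp
next
  case (Suc k)
  have r: "0 \<le> r" using assms(1) norm_ge_zero order_trans by blast
  have "x ^ Suc (Suc k) - y ^ Suc (Suc k) = x * (x ^ Suc k - y ^ Suc k) + (x - y) * y ^ Suc k"
    by (simp add: algebra_simps)
  also have "norm \<dots> \<le> norm x * norm (x ^ Suc k - y ^ Suc k) + norm (x - y) * norm (y ^ Suc k)"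
    by (meson add_mono norm_mult_ineq norm_triangle_le order_refl)
  also have "\<dots> \<le> r * (real (Suc k) * r ^ k * norm (x - y)) + norm (x - y) * r ^ Suc k"
  proof (intro add_mono mult_mono)
    show "norm (y ^ Suc k) \<le> r ^ Suc k"
      using norm_power_ineq[of y "Suc k"] power_mono[OF assms(2) norm_ge_zero, of "Suc k"] by linarith
  qed (use Suc assms r in auto)
  finally show ?case by (simp add: algebra_simps)
qed

text \<open>The difference of $k$-th powers is at most $k r^{k-1} \|x-y\|$; the factor $k$ cancels
  against the coefficient and leaves a geometric series.\<close>

lemma log_series_lipschitz:
  fixes x y :: "'a::{real_normed_algebra_1,banach}"
  assumes "norm x \<le> r" "norm y \<le> r" "r < 1"
  shows "norm (log_series x - log_series y) \<le> norm (x - y) / (1 - r)"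
proof -
  have r: "0 \<le> r" using assms(1) norm_ge_zero order_trans by blast
  define f where "f z k = ((-1) ^ Suc k / real k) *\<^sub>R (z::'a) ^ k" for z k
  have s: "summable (\<lambda>k. norm (f z k))" if "norm z \<le> r" for z
    unfolding f_def by (rule summable_norm_log_series) (use that assms in auto)
  have sd: "summable (\<lambda>k. f x k - f y k)"
    using s[OF assms(1)] s[OF assms(2)] summable_norm_cancel summable_diff by blast
  have b: "norm (f x (Suc k) - f y (Suc k)) \<le> r ^ k * norm (x - y)" for k
  proof -
    have "f x (Suc k) - f y (Suc k) = ((-1) ^ Suc (Suc k) / real (Suc k)) *\<^sub>R (x ^ Suc k - y ^ Suc k)"
      by (simp add: f_def algebra_simps)
    also have "norm \<dots> = norm (x ^ Suc k - y ^ Suc k) / real (Suc k)"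
      by (simp only: norm_scaleR abs_divide power_abs) simp
    also have "\<dots> \<le> (real (Suc k) * r ^ k * norm (x - y)) / real (Suc k)"
      by (intro divide_right_mono norm_power_diff_le assms) simp
    finally show ?thesis by simp
  qed
  have g: "(\<lambda>k. r ^ k * norm (x - y)) sums (1 / (1 - r) * norm (x - y))"
    by (intro sums_mult2 geometric_sums) (use r assms in auto)
  have "log_series x - log_series y = (\<Sum>k. f x k - f y k)"
    unfolding log_series_def f_def[symmetric]
    using s[OF assms(1)] s[OF assms(2)] summable_norm_cancel suminf_diff by blast
  also have "\<dots> = (\<Sum>k. f x (Suc k) - f y (Suc k))"
    using suminf_split_head[OF sd] by (simp add: f_def)
  also have "norm \<dots> \<le> (\<Sum>k. r ^ k * norm (x - y))"
    by (rule norm_suminf_le[OF b]) (use g in \<open>auto simp: sums_iff\<close>)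
  also have "\<dots> = norm (x - y) / (1 - r)" using g by (simp add: sums_iff)
  finally show ?thesis .
qed

lemma summable_norm_binomial_series:
  fixes x :: "'a::{real_normed_algebra_1,banach}"
  assumes "norm x < 1"
  shows "summable (\<lambda>k. norm ((s gchoose k) *\<^sub>R x ^ k))"
proof (rule summable_comparison_test'[where N = 0])
  have "ereal (norm x) < conv_radius (\<lambda>k. s gchoose k)"
    using assms by (simp add: conv_radius_gchoose one_ereal_def)
  then show "summable (\<lambda>k. norm ((s gchoose k) * norm x ^ k))"
    by (intro abs_summable_in_conv_radius) simp
  show "norm (norm ((s gchoose k) *\<^sub>R x ^ k)) \<le> norm ((s gchoose k) * norm x ^ k)" for k
    by (simp add: abs_mult mult_left_mono norm_power_ineq)
qed

lemma summable_binomial_series: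
  fixes x :: "'a::{real_normed_algebra_1,banach}"
  shows "norm x < 1 \<Longrightarrow> summable (\<lambda>k. (s gchoose k) *\<^sub>R x ^ k)"
  by (rule summable_norm_cancel[OF summable_norm_binomial_series])

text \<open>This is Vandermonde's identity, read off from the Cauchy product. It makes $s \mapsto
  (1+x)^s$ a one-parameter group, so that its derivative has to be computed at $s = 0$ only.\<close>

lemma binomial_series_add:
  fixes x :: "'a::{real_normed_algebra_1,banach}"
  assumes "norm x < 1"
  shows "binomial_series (s + t) x = binomial_series s x * binomial_series t x"
proof -
  have "(\<Sum>i\<le>k. ((s gchoose i) *\<^sub>R x ^ i) * ((t gchoose (k - i)) *\<^sub>R x ^ (k - i)))
      = ((s + t) gchoose k) *\<^sub>R x ^ k" for k
  proof -
    have "(\<Sum>i\<le>k. ((s gchoose i) *\<^sub>R x ^ i) * ((t gchoose (k - i)) *\<^sub>R x ^ (k - i)))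
        = (\<Sum>i\<le>k. ((s gchoose i) * (t gchoose (k - i))) *\<^sub>R x ^ k)"
      by (intro sum.cong refl) (simp add: mult.commute power_add[symmetric])
    also have "\<dots> = (\<Sum>i\<le>k. (s gchoose i) * (t gchoose (k - i))) *\<^sub>R x ^ k"
      by (simp add: scaleR_sum_left)
    finally show ?thesis by (simp add: gbinomial_Vandermonde[symmetric] atLeast0AtMost)
  qed
  then show ?thesis
    unfolding binomial_series_def
    using Cauchy_product[OF summable_norm_binomial_series[OF assms, of s]
        summable_norm_binomial_series[OF assms, of t]] by simp
qed

lemma binomial_series_0 [simp]: "binomial_series 0 (x :: 'a::{real_normed_algebra_1,banach}) = 1"
proof -
  have "(\<lambda>k. ((0::real) gchoose k) *\<^sub>R x ^ k) = (\<lambda>k. if k = 0 then 1 else 0)"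
    by (auto simp: fun_eq_iff gbinomial_0(2) gr0_conv_Suc)
  then show ?thesis
    using sums_unique[OF sums_single[of 0 "\<lambda>_. 1 :: 'a"]] by (simp add: binomial_series_def)
qed

lemma binomial_series_1 [simp]: "binomial_series 1 x = 1 + x"
proof -
  have "((1::real) gchoose k) = (if k < 2 then 1 else 0)" for k
  proof -
    have "(1 choose k) = (if k < 2 then 1 else 0)"
      by (auto simp: binomial_eq_0 less_2_cases_iff)
    then show ?thesis
      using binomial_gbinomial[of 1 k, where ?'a = real] by (metis of_nat_0 of_nat_1)
  qed
  then have "binomial_series 1 x = (\<Sum>k. (if k < 2 then 1 else 0::real) *\<^sub>R x ^ k)"
    by (simp add: binomial_series_def)
  also have "\<dots> = (\<Sum>k<2. (if k < 2 then 1 else 0::real) *\<^sub>R x ^ k)"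
    by (rule suminf_finite) auto
  also have "\<dots> = 1 + x" by (simp add: numeral_2_eq_2)
  finally show ?thesis .
qed

lemma gchoose_Suc_eq: "(h::real) gchoose Suc k = (h gchoose k) * ((h - real k) / real (Suc k))"
  by (simp add: gbinomial_prod_rev)

lemma abs_gchoose_le:
  fixes h :: real
  assumes "\<bar>h\<bar> \<le> 1"
  shows "\<bar>h gchoose Suc k\<bar> \<le> \<bar>h\<bar>"
proof (induction k)
  case (Suc k)
  have "\<bar>h gchoose Suc (Suc k)\<bar> = \<bar>h gchoose Suc k\<bar> * \<bar>(h - real (Suc k)) / real (Suc (Suc k))\<bar>"
    by (subst gchoose_Suc_eq) (simp only: abs_mult)
  also have "\<dots> \<le> \<bar>h\<bar> * 1"
    by (intro mult_mono Suc) (use assms in \<open>auto simp: abs_if divide_simps split: if_splits\<close>)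
  finally show ?case by simp
qed simp

lemma gchoose_div_tendsto:
  "((\<lambda>h::real. (h gchoose Suc k) / h) \<longlongrightarrow> (-1) ^ k / real (Suc k)) (at 0)"
proof (induction k)
  case 0
  have "((\<lambda>h::real. 1) \<longlongrightarrow> 1) (at 0)" by simp
  moreover have "\<forall>\<^sub>F h::real in at 0. 1 = (h gchoose Suc 0) / h"
    by (auto simp: eventually_at_filter)
  ultimately show ?case by (auto intro: Lim_transform_eventually)
next
  case (Suc k)
  have "((\<lambda>h::real. (h gchoose Suc k) / h * ((h - real (Suc k)) / real (Suc (Suc k))))
      \<longlongrightarrow> (-1) ^ k / real (Suc k) * ((0 - real (Suc k)) / real (Suc (Suc k)))) (at 0)"
    by (intro tendsto_mult Suc tendsto_divide tendsto_diff tendsto_ident_at tendsto_const) simp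
  also have "(-1) ^ k / real (Suc k) * ((0 - real (Suc k)) / real (Suc (Suc k)))
      = (-1) ^ Suc k / real (Suc (Suc k))"
    by (simp del: of_nat_Suc)
  finally show ?case by (subst gchoose_Suc_eq) (simp only: times_divide_eq_left)
qed

text \<open>Termwise, $\binom{h}{k}/h \to (-1)^{k+1}/k$ as $h \to 0$; the bound $|\binom{h}{k}/h| \le 1$
  for $|h| \le 1$ lets Tannery's theorem exchange limit and sum.\<close>

lemma binomial_series_deriv_0:
  fixes x :: "'a::{real_normed_algebra_1,banach}"
  assumes "norm x < 1"
  shows "((\<lambda>h. (binomial_series h x - 1) /\<^sub>R h) \<longlongrightarrow> log_series x) (at 0)"
proof -
  define a where "a k h = (if k = 0 then 0 else ((h gchoose k) / h) *\<^sub>R x ^ k)" for k and h :: real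
  define b where "b k = ((-1) ^ Suc k / real k) *\<^sub>R x ^ k" for k
  have lim: "((\<lambda>h. a k h) \<longlongrightarrow> b k) (at 0)" for k
  proof (cases k)
    case (Suc j)
    then show ?thesis unfolding a_def b_def
      using tendsto_scaleR[OF gchoose_div_tendsto[of j] tendsto_const[of "x ^ k"]] by simp
  qed (simp add: a_def b_def)
  have ab: "norm (a k h) \<le> norm x ^ k" if "\<bar>h\<bar> \<le> 1" for k h
  proof (cases k)
    case (Suc j)
    have "norm (a k h) = \<bar>(h gchoose Suc j) / h\<bar> * norm (x ^ k)"
      by (simp add: a_def Suc)
    also have "\<bar>(h gchoose Suc j) / h\<bar> \<le> 1"
      using abs_gchoose_le[OF that, of j] by (auto simp: divide_simps)
    then have "\<bar>(h gchoose Suc j) / h\<bar> * norm (x ^ k) \<le> 1 * norm x ^ k"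
      by (intro mult_mono norm_power_ineq) auto
    finally show ?thesis by simp
  qed (simp add: a_def)
  have ev: "\<forall>\<^sub>F h::real in at 0. \<bar>h\<bar> \<le> 1"
    unfolding eventually_at by (rule exI[of _ 1]) auto
  have bd: "eventually (\<lambda>(k,h). norm (a k h) \<le> norm x ^ k) (at_top \<times>\<^sub>F at 0)"
    using eventually_prodI[OF eventually_True[of at_top] ev]
    by (rule eventually_mono) (auto intro: ab)
  have lim_sum: "((\<lambda>h. suminf (\<lambda>k. a k h)) \<longlongrightarrow> suminf b) (at 0)"
    using tannerys_theorem[OF lim bd] assms by simp
  have quot: "suminf (\<lambda>k. a k h) = (binomial_series h x - 1) /\<^sub>R h" for h
  proof -
    have "(\<lambda>k. (h gchoose k) *\<^sub>R x ^ k) sums binomial_series h x"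
      using summable_binomial_series[OF assms] by (simp add: binomial_series_def summable_sums)
    from sums_diff[OF this sums_single[of 0 "\<lambda>_. 1"]]
    have "(\<lambda>k. inverse h *\<^sub>R ((h gchoose k) *\<^sub>R x ^ k - (if k = 0 then 1 else 0)))
        sums ((binomial_series h x - 1) /\<^sub>R h)"
      by (rule sums_scaleR_right)
    moreover have "inverse h *\<^sub>R ((h gchoose k) *\<^sub>R x ^ k - (if k = 0 then 1 else 0)) = a k h" for k
      by (auto simp: a_def divide_inverse mult.commute)
    ultimately show ?thesis by (simp add: sums_iff)
  qed
  have "suminf b = log_series x" by (simp add: b_def[abs_def] log_series_def)
  with lim_sum show ?thesis unfolding quot by (rule subst[rotated])
qed

lemma binomial_series_has_vector_derivative:
  fixes x :: "'a::{real_normed_algebra_1,banach}"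
  assumes "norm x < 1"
  shows "((\<lambda>s. binomial_series s x) has_vector_derivative log_series x * binomial_series s x) (at s)"
proof -
  let ?B = "\<lambda>s. binomial_series s x"
  have "((\<lambda>h. ((?B h - 1) /\<^sub>R h - log_series x) * ?B s) \<longlongrightarrow> (log_series x - log_series x) * ?B s) (at 0)"
    by (intro tendsto_intros binomial_series_deriv_0 assms)
  then have "((\<lambda>h. norm (((?B h - 1) /\<^sub>R h - log_series x) * ?B s)) \<longlongrightarrow> 0) (at 0)"
    using tendsto_norm_zero by force
  moreover have "\<forall>\<^sub>F h in at 0. norm (((?B h - 1) /\<^sub>R h - log_series x) * ?B s) =
      norm (?B (s + h) - ?B s - h *\<^sub>R (log_series x * ?B s)) / norm h"
  proof -
    have "norm (((?B h - 1) /\<^sub>R h - log_series x) * ?B s) =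
      norm (?B (s + h) - ?B s - h *\<^sub>R (log_series x * ?B s)) / norm h" if "h \<noteq> 0" for h
    proof -
      have "?B (s + h) = ?B h * ?B s" by (simp add: add.commute binomial_series_add assms)
      then have "((?B h - 1) /\<^sub>R h - log_series x) * ?B s
          = inverse h *\<^sub>R (?B (s + h) - ?B s - h *\<^sub>R (log_series x * ?B s))"
        using that by (simp add: algebra_simps)
      then show ?thesis by (simp add: divide_inverse mult.commute)
    qed
    then show ?thesis by (auto simp: eventually_at_filter)
  qed
  ultimately have "((\<lambda>h. norm (?B (s + h) - ?B s - h *\<^sub>R (log_series x * ?B s)) / norm h) \<longlongrightarrow> 0) (at 0)"
    by (rule Lim_transform_eventually)
  then show ?thesis
    unfolding has_vector_derivative_def has_derivative_at by (simp add: bounded_linear_scaleR_left)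
qed

text \<open>Both sides are one-parameter groups with the same generator: the product of $\exp(-sL)$ with
  the binomial series has derivative $0$.\<close>

theorem exp_scaleR_log_series:
  fixes x :: "'a::{real_normed_algebra_1,banach}"
  assumes "norm x < 1"
  shows "exp (s *\<^sub>R log_series x) = binomial_series s x"
proof -
  let ?L = "log_series x"
  define g where "g s = exp (s *\<^sub>R (- ?L)) * binomial_series s x" for s
  have "(g has_vector_derivative 0) (at s)" for s
  proof -
    have e: "((\<lambda>s. exp (s *\<^sub>R (- ?L))) has_vector_derivative exp (s *\<^sub>R (- ?L)) * (- ?L)) (at s)"
      by (rule exp_scaleR_has_vector_derivative_right)
    have "exp (s *\<^sub>R (- ?L)) * (?L * binomial_series s x)
        + exp (s *\<^sub>R (- ?L)) * (- ?L) * binomial_series s x = 0"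
      by (simp only: mult.assoc mult_minus_left mult_minus_right add.right_inverse)
    then show ?thesis
      unfolding g_def[abs_def]
      using has_vector_derivative_mult[OF e binomial_series_has_vector_derivative[OF assms]]
      by (simp only:)
  qed
  then obtain c where c: "\<And>s. s \<in> UNIV \<Longrightarrow> g s = c"
    using has_vector_derivative_zero_constant[OF convex_UNIV, of g] by (metis (no_types))
  have "g 0 = 1" by (simp add: g_def)
  then have "g s = 1" using c[of s] c[of 0] by simp
  then have "exp (s *\<^sub>R ?L) * (exp (- (s *\<^sub>R ?L)) * binomial_series s x) = exp (s *\<^sub>R ?L)"
    by (simp add: g_def)
  then show ?thesis by (simp only: mult.assoc[symmetric] exp_minus_inverse mult_1_left)
qed

corollary exp_log_series:
  fixes x :: "'a::{real_normed_algebra_1,banach}"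
  assumes "norm x < 1"
  shows "exp (log_series x) = 1 + x"
  using exp_scaleR_log_series[OF assms, of 1] by simp

corollary log_series_real:
  fixes x :: real
  assumes "norm x < 1"
  shows "log_series x = ln (1 + x)"
  using exp_log_series[OF assms] by (metis ln_exp)

text \<open>All factors $s - j$ with $j \ge 1$ are nonpositive for $s \in [0,1]$, so the signs
  alternate.\<close>

lemma gchoose_alternating:
  fixes s :: real
  assumes "0 \<le> s" "s \<le> 1"
  shows "\<bar>s gchoose Suc k\<bar> = (-1) ^ k * (s gchoose Suc k)"
proof (induction k)
  case 0
  then show ?case using assms(1) by simp
next
  case (Suc k)
  have "\<bar>s gchoose Suc (Suc k)\<bar> = \<bar>s gchoose Suc k\<bar> * \<bar>(s - real (Suc k)) / real (Suc (Suc k))\<bar>"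
    by (subst gchoose_Suc_eq) (simp only: abs_mult)
  also have "\<bar>(s - real (Suc k)) / real (Suc (Suc k))\<bar> = - ((s - real (Suc k)) / real (Suc (Suc k)))"
    by (rule abs_of_nonpos) (use assms in \<open>auto simp: divide_simps\<close>)
  finally show ?case by (subst gchoose_Suc_eq[of s "Suc k"]) (simp only: Suc power_Suc mult_minus_left mult_minus_right mult_1_left mult.assoc)
qed

lemma exp_scaleR_log_series_minus_1:
  fixes x :: "'a::{real_normed_algebra_1,banach}"
  assumes "norm x < 1"
  shows "exp (s *\<^sub>R log_series x) - 1 = (\<Sum>k. (s gchoose Suc k) *\<^sub>R x ^ Suc k)"
  using suminf_split_head[OF summable_binomial_series[OF assms, of s]]
  by (simp add: exp_scaleR_log_series[OF assms] binomial_series_def)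

text \<open>Since the coefficients $\binom{s}{k}$ alternate in sign for $s \in [0,1]$, the norms of the
  terms other than the first add up to at most minus the corresponding sum of the real series at
  $-\|x\|$, that is to $1 - (1 - \|x\|)^s$. This is the quantitative heart of the stability
  proof: the right-hand side is less than $1$, and of order $s$ as $s \to 0$.\<close>

theorem norm_exp_scaleR_log_series:
  fixes x :: "'a::{real_normed_algebra_1,banach}"
  assumes x: "norm x < 1" and s: "0 \<le> s" "s \<le> 1"
  shows "norm (exp (s *\<^sub>R log_series x) - 1) \<le> 1 - exp (s * ln (1 - norm x))"
proof -
  define r where "r = norm x"
  have r: "0 \<le> r" "r < 1" using x by (auto simp: r_def)
  have nr: "norm (- r) < 1" using r by simp
  have t: "(s gchoose Suc k) * (- r) ^ Suc k = - (\<bar>s gchoose Suc k\<bar> * r ^ Suc k)" for k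
    unfolding gchoose_alternating[OF s] power_minus[of r "Suc k"] by simp
  have sm: "summable (\<lambda>k. \<bar>s gchoose Suc k\<bar> * r ^ Suc k)"
    using summable_Suc_iff[THEN iffD2, OF summable_norm_binomial_series[OF nr, of s]] r
    by (simp add: abs_mult power_abs)
  have "exp (s * ln (1 - r)) - 1 = (\<Sum>k. (s gchoose Suc k) * (- r) ^ Suc k)"
    using exp_scaleR_log_series_minus_1[OF nr, of s] unfolding log_series_real[OF nr] real_scaleR_def
    by (simp only: add_uminus_conv_diff)
  then have real: "1 - exp (s * ln (1 - r)) = (\<Sum>k. \<bar>s gchoose Suc k\<bar> * r ^ Suc k)"
    unfolding t suminf_minus[OF sm] by linarith
  have "norm (\<Sum>k. (s gchoose Suc k) *\<^sub>R x ^ Suc k) \<le> (\<Sum>k. \<bar>s gchoose Suc k\<bar> * r ^ Suc k)"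
  proof (rule norm_suminf_le[OF _ sm])
    show "norm ((s gchoose Suc k) *\<^sub>R x ^ Suc k) \<le> \<bar>s gchoose Suc k\<bar> * r ^ Suc k" for k
      unfolding norm_scaleR real_norm_def r_def by (intro mult_left_mono norm_power_ineq) auto
  qed
  then show ?thesis unfolding exp_scaleR_log_series_minus_1[OF x] real[unfolded r_def] r_def .
qed

section \<open>Uniqueness for ordinary differential equations\<close>

lemma has_vector_derivative_iff_quotient:
  fixes f :: "real \<Rightarrow> 'a::real_normed_vector"
  shows "(f has_vector_derivative D) (at t within S) \<longleftrightarrow>
    ((\<lambda>s. (f s - f t) /\<^sub>R (s - t)) \<longlongrightarrow> D) (at t within S)"
proof -
  have eq: "norm (f s - f t - (s - t) *\<^sub>R D) / norm (s - t) = norm ((f s - f t) /\<^sub>R (s - t) - D)"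
    if "s \<noteq> t" for s
  proof -
    have "(f s - f t) /\<^sub>R (s - t) - D = (f s - f t - (s - t) *\<^sub>R D) /\<^sub>R (s - t)"
      using that by (simp add: scaleR_diff_right)
    then show ?thesis by (simp add: divide_inverse mult.commute)
  qed
  have "(f has_vector_derivative D) (at t within S) \<longleftrightarrow>
      ((\<lambda>s. norm (f s - f t - (s - t) *\<^sub>R D) / norm (s - t)) \<longlongrightarrow> 0) (at t within S)"
    by (simp add: has_vector_derivative_def has_derivative_iff_norm bounded_linear_scaleR_left)
  also have "\<dots> \<longleftrightarrow> ((\<lambda>s. norm ((f s - f t) /\<^sub>R (s - t) - D)) \<longlongrightarrow> 0) (at t within S)"
    by (rule filterlim_cong[OF refl refl]) (use eq in \<open>auto simp: eventually_at_filter\<close>)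
  also have "\<dots> \<longleftrightarrow> ((\<lambda>s. (f s - f t) /\<^sub>R (s - t)) \<longlongrightarrow> D) (at t within S)"
    by (simp only: tendsto_norm_zero_iff LIM_zero_iff)
  finally show ?thesis .
qed

text \<open>The difference quotient of $Z$ is $-Z(s)\,q(s)\,Z(t)$ with $q$ the difference quotient of
  $X$, so it suffices that $Z$ is continuous at $t$. For $s$ near $t$ the same identity bounds
  $\|Z(s)\|$ by $2\|Z(t)\|$, and then gives continuity.\<close>

lemma has_vector_derivative_algebra_inverse:
  fixes X Z :: "real \<Rightarrow> 'a::real_normed_algebra_1"
  assumes XZ: "\<And>s. s \<in> S \<Longrightarrow> X s * Z s = 1 \<and> Z s * X s = 1"
    and t: "t \<in> S"
    and X: "(X has_vector_derivative D) (at t within S)"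
  shows "(Z has_vector_derivative - (Z t * D * Z t)) (at t within S)"
proof -
  have diff: "Z s - Z t = - (Z s * (X s - X t) * Z t)" if "s \<in> S" for s
  proof -
    have "Z s * (X s - X t) * Z t = (Z s * X s) * Z t - Z s * (X t * Z t)"
      by (simp add: algebra_simps)
    then show ?thesis using XZ[OF that] XZ[OF t] by simp
  qed
  have lim: "(X \<longlongrightarrow> X t) (at t within S)"
    using has_vector_derivative_continuous[OF X] by (simp add: continuous_within)
  have small: "\<forall>\<^sub>F s in at t within S. norm (X s - X t) * norm (Z t) < 1 / 2"
  proof -
    have "((\<lambda>s. norm (X s - X t) * norm (Z t)) \<longlongrightarrow> norm (X t - X t) * norm (Z t)) (at t within S)"
      by (intro tendsto_intros lim)
    then show ?thesis by (rule order_tendstoD) simp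
  qed
  have inS: "\<forall>\<^sub>F s in at t within S. s \<in> S"
    by (simp add: eventually_at_filter)
  have bd: "\<forall>\<^sub>F s in at t within S. norm (Z s - Z t) \<le> 2 * norm (Z t) * norm (Z t) * norm (X s - X t)"
    using small inS
  proof eventually_elim
    case (elim s)
    let ?q = "norm (X s - X t) * norm (Z t)"
    have "norm (Z s - Z t) \<le> norm (Z s) * ?q"
    proof -
      have "norm (Z s - Z t) \<le> norm (Z s * (X s - X t)) * norm (Z t)"
        using diff[OF elim(2)] norm_mult_ineq[of "Z s * (X s - X t)" "Z t"] by simp
      also have "\<dots> \<le> (norm (Z s) * norm (X s - X t)) * norm (Z t)"
        by (intro mult_right_mono norm_mult_ineq) simp
      finally show ?thesis by (simp add: mult.assoc)
    qed
    moreover have "norm (Z s) \<le> norm (Z t) + norm (Z s - Z t)"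
      by (rule norm_triangle_sub)
    moreover have "norm (Z s) * ?q \<le> norm (Z s) * (1 / 2)"
      using elim(1) by (intro mult_left_mono) auto
    ultimately have "norm (Z s) \<le> 2 * norm (Z t)" by linarith
    then have "norm (Z s) * ?q \<le> 2 * norm (Z t) * ?q"
      by (rule mult_right_mono) simp
    with \<open>norm (Z s - Z t) \<le> norm (Z s) * ?q\<close> show ?case by (simp add: mult.commute mult.left_commute)
  qed
  have "((\<lambda>s. 2 * norm (Z t) * norm (Z t) * norm (X s - X t)) \<longlongrightarrow>
      2 * norm (Z t) * norm (Z t) * norm (X t - X t)) (at t within S)"
    by (intro tendsto_intros lim)
  then have "((\<lambda>s. Z s - Z t) \<longlongrightarrow> 0) (at t within S)"
    using Lim_null_comparison[OF bd] by simp
  then have Zlim: "(Z \<longlongrightarrow> Z t) (at t within S)" by (simp only: LIM_zero_iff)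
  have "((\<lambda>s. - (Z s * ((X s - X t) /\<^sub>R (s - t)) * Z t)) \<longlongrightarrow> - (Z t * D * Z t)) (at t within S)"
    using X unfolding has_vector_derivative_iff_quotient by (intro tendsto_intros Zlim)
  moreover have "\<forall>\<^sub>F s in at t within S. - (Z s * ((X s - X t) /\<^sub>R (s - t)) * Z t) = (Z s - Z t) /\<^sub>R (s - t)"
    using inS by eventually_elim (simp add: diff)
  ultimately show ?thesis
    unfolding has_vector_derivative_iff_quotient by (rule Lim_transform_eventually)
qed

text \<open>On an interval so short that $C |t - \tau| \le 1/2$, the mean value inequality bounds the
  maximum of $\|y - z\|$ by half of itself.\<close>

lemma lipschitz_ode_agree_locally:
  fixes y z :: "real \<Rightarrow> 'a::real_normed_vector" and f :: "'a \<Rightarrow> 'a"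
  assumes y: "\<And>t. t \<in> {c..d} \<Longrightarrow> (y has_vector_derivative f (y t)) (at t within {c..d})"
    and z: "\<And>t. t \<in> {c..d} \<Longrightarrow> (z has_vector_derivative f (z t)) (at t within {c..d})"
    and lip: "\<And>t. t \<in> {c..d} \<Longrightarrow> norm (f (y t) - f (z t)) \<le> C * norm (y t - z t)"
    and short: "\<And>t. t \<in> {c..d} \<Longrightarrow> C * \<bar>t - \<tau>\<bar> \<le> 1 / 2"
    and \<tau>: "\<tau> \<in> {c..d}" "y \<tau> = z \<tau>" and C: "0 \<le> C"
    and t: "t \<in> {c..d}"
  shows "y t = z t"
proof -
  define w where "w t = y t - z t" for t
  have w': "(w has_vector_derivative f (y t) - f (z t)) (at t within {c..d})" if "t \<in> {c..d}" for t
    unfolding w_def[abs_def] by (intro derivative_intros y z that)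
  have "continuous_on {c..d} w"
    unfolding continuous_on_eq_continuous_within
    using has_vector_derivative_continuous[OF w'] by blast
  then have "continuous_on {c..d} (\<lambda>t. norm (w t))" by (rule continuous_on_norm)
  then obtain m where m: "m \<in> {c..d}" "\<And>t. t \<in> {c..d} \<Longrightarrow> norm (w t) \<le> norm (w m)"
    using continuous_attains_sup[of "{c..d}" "\<lambda>t. norm (w t)"] \<tau> by (metis compact_Icc empty_iff)
  have "norm (w m - w \<tau> - (m - \<tau>) *\<^sub>R (f (y \<tau>) - f (z \<tau>))) \<le> norm (m - \<tau>) * (C * norm (w m))"
  proof (rule vector_differentiable_bound_linearization[where S = "{c..d}" and f' = "\<lambda>t. f (y t) - f (z t)"])
    show "closed_segment \<tau> m \<subseteq> {c..d}"
      using \<tau>(1) m(1) by (intro closed_segment_subset) auto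
    show "norm (f (y t) - f (z t) - (f (y \<tau>) - f (z \<tau>))) \<le> C * norm (w m)" if "t \<in> {c..d}" for t
    proof -
      have "norm (f (y t) - f (z t)) \<le> C * norm (w t)" using lip[OF that] by (simp add: w_def)
      also have "\<dots> \<le> C * norm (w m)" by (intro mult_left_mono m that C)
      finally show ?thesis using \<tau>(2) by simp
    qed
  qed (use w' \<tau>(1) in auto)
  then have "norm (w m) \<le> (C * \<bar>m - \<tau>\<bar>) * norm (w m)"
    using \<tau>(2) by (simp add: w_def mult.commute mult.left_commute)
  also have "\<dots> \<le> 1 / 2 * norm (w m)"
    by (intro mult_right_mono short m) simp
  finally have "norm (w m) = 0" using norm_ge_zero[of "w m"] by linarith
  with m(2)[OF t] show ?thesis by (simp add: w_def)
qed

text \<open>The times at which the two solutions agree form a closed subset of the interval, and an open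
  one by the local statement; an interval is connected. The Lipschitz condition is needed only
  near the known solution $z$, which allows a field that is badly behaved elsewhere.\<close>

theorem locally_lipschitz_ode_unique:
  fixes y z :: "real \<Rightarrow> 'a::real_normed_vector" and f :: "'a \<Rightarrow> 'a"
  assumes y: "\<And>t. t \<in> {a..b} \<Longrightarrow> (y has_vector_derivative f (y t)) (at t within {a..b})"
    and z: "\<And>t. t \<in> {a..b} \<Longrightarrow> (z has_vector_derivative f (z t)) (at t within {a..b})"
    and lip: "\<And>t. t \<in> {a..b} \<Longrightarrow>
      \<exists>e>0. \<exists>C. \<forall>p\<in>ball (z t) e. \<forall>q\<in>ball (z t) e. norm (f p - f q) \<le> C * norm (p - q)"
    and init: "y a = z a" and t: "t \<in> {a..b}"
  shows "y t = z t"
proof -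
  have cy: "continuous_on {a..b} y" and cz: "continuous_on {a..b} z"
    unfolding continuous_on_eq_continuous_within
    using has_vector_derivative_continuous[OF y] has_vector_derivative_continuous[OF z] by blast+
  define K where "K = {t \<in> {a..b}. y t - z t = 0}"
  have closed: "closedin (top_of_set {a..b}) K"
    unfolding K_def by (intro continuous_closedin_preimage_constant continuous_intros cy cz)
  have "\<exists>h>0. \<forall>s\<in>{a..b}. dist s \<tau> < h \<longrightarrow> s \<in> K" if "\<tau> \<in> K" for \<tau>
  proof -
    have \<tau>: "\<tau> \<in> {a..b}" "y \<tau> = z \<tau>" using that by (auto simp: K_def)
    obtain e C where e: "e > 0"
      and C: "\<And>p q. p \<in> ball (z \<tau>) e \<Longrightarrow> q \<in> ball (z \<tau>) e \<Longrightarrow> norm (f p - f q) \<le> C * norm (p - q)"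
      using lip[OF \<tau>(1)] by blast
    obtain h1 where h1: "h1 > 0" "\<And>s. s \<in> {a..b} \<Longrightarrow> dist s \<tau> < h1 \<Longrightarrow> dist (y s) (y \<tau>) < e"
      using cy \<tau>(1) e unfolding continuous_on_iff by blast
    obtain h2 where h2: "h2 > 0" "\<And>s. s \<in> {a..b} \<Longrightarrow> dist s \<tau> < h2 \<Longrightarrow> dist (z s) (z \<tau>) < e"
      using cz \<tau>(1) e unfolding continuous_on_iff by blast
    define D where "D = \<bar>C\<bar> + 1"
    define h where "h = min (1 / D) (min h1 h2) / 2"
    have D: "D > 0" "C \<le> D" by (auto simp: D_def)
    have h: "h > 0" "h < h1" "h < h2" "h \<le> 1 / D / 2"
      using h1(1) h2(1) D by (auto simp: h_def)
    then have Dh: "D * h \<le> 1 / 2" using D by (simp add: field_simps)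
    have "s \<in> K" if s: "s \<in> {a..b}" "dist s \<tau> < h" for s
    proof -
      let ?c = "max a (\<tau> - h)" and ?d = "min b (\<tau> + h)"
      have sub: "{?c..?d} \<subseteq> {a..b}" by auto
      have near: "dist r \<tau> \<le> h" if "r \<in> {?c..?d}" for r
        using that by (auto simp: dist_real_def)
      have "y s = z s"
      proof (rule lipschitz_ode_agree_locally[where y = y and z = z and f = f and c = ?c and d = ?d and C = D and \<tau> = \<tau>])
        fix r assume r: "r \<in> {?c..?d}"
        then have ab: "r \<in> {a..b}" using sub by blast
        show "(y has_vector_derivative f (y r)) (at r within {?c..?d})"
          by (rule has_vector_derivative_within_subset[OF y[OF ab] sub])
        show "(z has_vector_derivative f (z r)) (at r within {?c..?d})"
          by (rule has_vector_derivative_within_subset[OF z[OF ab] sub])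
        have "norm (f (y r) - f (z r)) \<le> C * norm (y r - z r)"
          using h1(2)[OF ab] h2(2)[OF ab] near[OF r] h \<tau>(2)
          by (intro C) (auto simp: dist_commute)
        also have "\<dots> \<le> D * norm (y r - z r)" by (intro mult_right_mono D) simp
        finally show "norm (f (y r) - f (z r)) \<le> D * norm (y r - z r)" .
        have "D * \<bar>r - \<tau>\<bar> \<le> D * h"
          using near[OF r] D by (intro mult_left_mono) (auto simp: dist_real_def)
        then show "D * \<bar>r - \<tau>\<bar> \<le> 1 / 2" using Dh by linarith
      next
        show "s \<in> {?c..?d}" using s by (auto simp: dist_real_def)
        show "\<tau> \<in> {?c..?d}" using \<tau>(1) h(1) by auto
      qed (use \<tau> D in auto)
      then show ?thesis using s by (simp add: K_def)
    qed
    with h(1) show ?thesis by blast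
  qed
  moreover have "K \<subseteq> {a..b}" by (auto simp: K_def)
  ultimately have opn: "openin (top_of_set {a..b}) K"
    unfolding openin_euclidean_subtopology_iff by blast
  have "K = {} \<or> K = {a..b}"
    using connected_Icc[of a b] closed opn unfolding connected_clopen by blast
  moreover have "a \<in> K" using init t by (simp add: K_def)
  ultimately have "t \<in> K" using t by blast
  then show ?thesis by (simp add: K_def)
qed

section \<open>One-parameter subgroups of closed groups\<close>

text \<open>Dropping the constant and linear terms of the exponential series leaves a map whose
  Lipschitz constant on the ball of radius $r$ is $e^r - 1$, which is small for small $r$. It
  quantifies that $\exp$ is close to $x \mapsto 1 + x$ near $0$ and gives continuity,
  injectivity and the first order estimates below.\<close>

lemma exp_minus_id_lipschitz:
  fixes x y :: "'a::{real_normed_algebra_1,banach}"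
  assumes "norm x \<le> r" "norm y \<le> r"
  shows "norm ((exp x - x) - (exp y - y)) \<le> (exp r - 1) * norm (x - y)"
proof -
  have r: "0 \<le> r" using assms(1) norm_ge_zero order_trans by blast
  define f where "f z n = inverse (fact (n + 2)) *\<^sub>R (z::'a) ^ (n + 2)" for z n
  have sm: "summable (f z)" for z
    unfolding f_def by (rule summable_ignore_initial_segment[OF summable_exp_generic])
  have b: "norm (f x n - f y n) \<le> inverse (fact (Suc n)) * r ^ Suc n * norm (x - y)" for n
  proof -
    have "norm (f x n - f y n) = inverse (fact (n + 2)) * norm (x ^ Suc (Suc n) - y ^ Suc (Suc n))"
      by (simp add: f_def scaleR_diff_right[symmetric])
    also have "\<dots> \<le> inverse (fact (n + 2)) * (real (Suc (Suc n)) * r ^ Suc n * norm (x - y))"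
      by (intro mult_left_mono norm_power_diff_le assms) simp
    also have "\<dots> = inverse (fact (Suc n)) * r ^ Suc n * norm (x - y)"
      by (simp add: divide_simps)
    finally show ?thesis .
  qed
  have "(\<lambda>n. inverse (fact (Suc n)) *\<^sub>R r ^ Suc n) sums (exp r - 1)"
    using exp_converges[of r] by (subst sums_Suc_iff) simp
  then have g: "(\<lambda>n. inverse (fact (Suc n)) * r ^ Suc n * norm (x - y)) sums ((exp r - 1) * norm (x - y))"
    by (intro sums_mult2) simp
  have exp_eq: "exp z = 1 + z + suminf (f z)" for z
    unfolding f_def[abs_def] by (rule exp_first_two_terms)
  have "(exp x - x) - (exp y - y) = suminf (f x) - suminf (f y)"
    by (simp add: exp_eq)
  also have "\<dots> = (\<Sum>n. f x n - f y n)" by (rule suminf_diff[OF sm sm])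
  also have "norm \<dots> \<le> (\<Sum>n. inverse (fact (Suc n)) * r ^ Suc n * norm (x - y))"
    by (rule norm_suminf_le[OF b sums_summable[OF g]])
  also have "\<dots> = (exp r - 1) * norm (x - y)" using g by (simp add: sums_iff)
  finally show ?thesis .
qed

lemma norm_exp_diff_ge:
  fixes x y :: "'a::{real_normed_algebra_1,banach}"
  assumes "norm x \<le> r" "norm y \<le> r"
  shows "(2 - exp r) * norm (x - y) \<le> norm (exp x - exp y)"
proof -
  have "x - y = (exp x - exp y) - ((exp x - x) - (exp y - y))" by simp
  then have "norm (x - y) \<le> norm (exp x - exp y) + norm ((exp x - x) - (exp y - y))"
    using norm_triangle_ineq4[of "exp x - exp y" "(exp x - x) - (exp y - y)"] by simp
  with exp_minus_id_lipschitz[OF assms] show ?thesis by (simp add: algebra_simps)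
qed

lemma exp_half_less_2: "exp (1 / 2 :: real) < 2"
  using exp_bound[of "1 / 2"] by (simp add: power2_eq_square)

lemma exp_inj_small:
  fixes x y :: "'a::{real_normed_algebra_1,banach}"
  assumes "norm x \<le> 1 / 2" "norm y \<le> 1 / 2" "exp x = exp y"
  shows "x = y"
proof -
  have "(2 - exp (1 / 2)) * norm (x - y) \<le> 0"
    using norm_exp_diff_ge[OF assms(1,2)] assms(3) by simp
  then have "norm (x - y) \<le> 0"
    using exp_half_less_2 by (simp add: mult_le_0_iff)
  then show ?thesis by simp
qed

lemma continuous_exp_algebra:
  "isCont exp (x :: 'a::{real_normed_algebra_1,banach})"
proof -
  have "((\<lambda>y. exp y - y) \<longlongrightarrow> exp x - x) (at x)"
  proof -
    let ?C = "exp (norm x + 1) - 1"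
    have "\<forall>\<^sub>F y in at x. dist y x < 1" unfolding eventually_at by (rule exI[of _ 1]) auto
    then have ev: "\<forall>\<^sub>F y in at x. norm ((exp y - y) - (exp x - x)) \<le> ?C * norm (y - x)"
    proof eventually_elim
      case (elim y)
      then show ?case
        using norm_triangle_sub[of y x] by (intro exp_minus_id_lipschitz) (auto simp: dist_norm)
    qed
    have "((\<lambda>y. ?C * norm (y - x)) \<longlongrightarrow> ?C * norm (x - x)) (at x)"
      by (intro tendsto_intros)
    then have "((\<lambda>y. (exp y - y) - (exp x - x)) \<longlongrightarrow> 0) (at x)"
      using Lim_null_comparison[OF ev] by simp
    then show ?thesis by (simp only: LIM_zero_iff)
  qed
  from tendsto_add[OF this tendsto_ident_at] show ?thesis by (simp add: isCont_def)
qed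

lemma tendsto_exp_algebra:
  fixes f :: "'b \<Rightarrow> 'a::{real_normed_algebra_1,banach}"
  shows "(f \<longlongrightarrow> l) F \<Longrightarrow> ((\<lambda>x. exp (f x)) \<longlongrightarrow> exp l) F"
  by (rule isCont_tendsto_compose[OF continuous_exp_algebra])

lemma exp_scaleR_of_nat:
  fixes x :: "'a::{real_normed_algebra_1,banach}"
  shows "exp (real n *\<^sub>R x) = exp x ^ n"
proof (induction n)
  case (Suc n)
  have "exp (real (Suc n) *\<^sub>R x) = exp (x + real n *\<^sub>R x)" by (simp add: algebra_simps)
  also have "\<dots> = exp x * exp (real n *\<^sub>R x)" by (rule exp_add_commuting) simp
  finally show ?case using Suc by simp
qed simp

text \<open>With $n = \|N\|$, the bound is $mn\,e^{mn}(e^n - 1)$: it tends to $0$ when $N \to 0$ while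
  $mN$ stays bounded. This compares powers of group elements $1 + N$ with a one-parameter
  group.\<close>

lemma norm_power_one_plus_minus_exp:
  fixes N :: "'a::{real_normed_algebra_1,banach}"
  shows "norm ((1 + N) ^ m - exp (real m *\<^sub>R N)) \<le>
    norm (real m *\<^sub>R N) * exp (norm (real m *\<^sub>R N)) * (exp (norm N) - 1)"
proof (cases m)
  case 0 then show ?thesis by simp
next
  case (Suc j)
  let ?r = "exp (norm N)"
  have 1: "norm (1 + N) \<le> ?r"
    using order_trans[OF norm_triangle_ineq[of 1 N]] exp_ge_add_one_self[of "norm N"] by simp
  have "norm ((1 + N) ^ m - exp N ^ m) \<le> real m * ?r ^ j * norm ((1 + N) - exp N)"
    unfolding Suc by (rule norm_power_diff_le[OF 1 norm_exp])
  also have "\<dots> \<le> real m * ?r ^ m * ((?r - 1) * norm N)"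
  proof (intro mult_mono)
    show "?r ^ j \<le> ?r ^ m" by (rule power_increasing) (auto simp: Suc)
    show "norm ((1 + N) - exp N) \<le> (?r - 1) * norm N"
      using exp_minus_id_lipschitz[of N "norm N" 0] norm_minus_commute[of "1 + N" "exp N"]
      by (simp add: algebra_simps)
  qed auto
  also have "?r ^ m = exp (norm (real m *\<^sub>R N))" by (simp add: exp_of_nat_mult)
  finally show ?thesis by (simp add: exp_scaleR_of_nat mult_ac)
qed

locale closed_unit_subgroup =
  fixes G :: "'a::{real_normed_algebra_1,heine_borel,banach} set"
  assumes one: "1 \<in> G"
    and mult: "\<And>g h. g \<in> G \<Longrightarrow> h \<in> G \<Longrightarrow> g * h \<in> G"
    and inv: "\<And>g. g \<in> G \<Longrightarrow> \<exists>h\<in>G. g * h = 1 \<and> h * g = 1"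
    and closed: "\<And>f x y. (\<And>k::nat. f k \<in> G) \<Longrightarrow> f \<longlonglongrightarrow> x \<Longrightarrow> x * y = 1 \<Longrightarrow> y * x = 1 \<Longrightarrow> x \<in> G"
begin

text \<open>The Lie algebra of the group.\<close>

definition generators :: "'a set" where
  "generators = {A. \<forall>t::real. exp (t *\<^sub>R A) \<in> G}"

lemma power_mem: "g \<in> G \<Longrightarrow> g ^ n \<in> G"
  by (induction n) (auto intro: one mult)

lemma exp_mem_limit: "(\<And>k::nat. f k \<in> G) \<Longrightarrow> f \<longlonglongrightarrow> exp A \<Longrightarrow> exp A \<in> G"
  using closed[of f "exp A" "exp (- A)"] exp_minus_inverse[of A] exp_minus_inverse[of "- A"] by simp

lemma exp_minus_mem:
  assumes "exp A \<in> G" shows "exp (- A) \<in> G"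
proof -
  obtain h where h: "h \<in> G" "exp A * h = 1" using inv[OF assms] by blast
  have "exp (- A) = exp (- A) * (exp A * h)" using h by simp
  also have "\<dots> = h" using exp_minus_inverse[of "- A"] by (simp add: mult.assoc[symmetric])
  finally show ?thesis using h by simp
qed

text \<open>The basic step of Cartan's closed subgroup theorem. If $m = \lfloor tc_k \rfloor$, then the
  power $(1 + N_k)^m$ lies in the group and tends to $\exp(tA)$.\<close>

lemma limit_direction_mem_generators:
  fixes N :: "nat \<Rightarrow> 'a" and c :: "nat \<Rightarrow> real"
  assumes mem: "\<And>k. 1 + N k \<in> G" and N: "N \<longlonglongrightarrow> 0"
    and c: "\<And>k. 0 \<le> c k" and lim: "(\<lambda>k. c k *\<^sub>R N k) \<longlonglongrightarrow> A"
  shows "A \<in> generators"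
proof -
  have pos: "exp (t *\<^sub>R A) \<in> G" if t: "0 \<le> t" for t
  proof -
    define m where "m k = nat \<lfloor>t * c k\<rfloor>" for k
    have m: "\<bar>real (m k) - t * c k\<bar> \<le> 1" for k
      using mult_nonneg_nonneg[OF t c[of k]] unfolding m_def by linarith
    have "(\<lambda>k. (real (m k) - t * c k) *\<^sub>R N k) \<longlonglongrightarrow> 0"
    proof (rule Lim_null_comparison)
      show "\<forall>\<^sub>F k in sequentially. norm ((real (m k) - t * c k) *\<^sub>R N k) \<le> norm (N k)"
        using mult_right_mono[OF m norm_ge_zero] by (intro always_eventually) auto
      show "(\<lambda>k. norm (N k)) \<longlonglongrightarrow> 0" using N by (rule tendsto_norm_zero)
    qed
    from tendsto_add[OF tendsto_scaleR[OF tendsto_const[of t] lim] this]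
    have mN: "(\<lambda>k. real (m k) *\<^sub>R N k) \<longlonglongrightarrow> t *\<^sub>R A" by (simp add: scaleR_diff_left)
    have "(\<lambda>k. norm (real (m k) *\<^sub>R N k) * exp (norm (real (m k) *\<^sub>R N k)) * (exp (norm (N k)) - 1))
        \<longlonglongrightarrow> norm (t *\<^sub>R A) * exp (norm (t *\<^sub>R A)) * (exp (norm (0::'a)) - 1)"
      by (intro tendsto_intros mN N)
    then have "(\<lambda>k. norm (real (m k) *\<^sub>R N k) * exp (norm (real (m k) *\<^sub>R N k)) * (exp (norm (N k)) - 1))
        \<longlonglongrightarrow> 0" by simp
    then have "(\<lambda>k. (1 + N k) ^ m k - exp (real (m k) *\<^sub>R N k)) \<longlonglongrightarrow> 0"
      by (rule Lim_null_comparison[rotated])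
        (intro always_eventually allI norm_power_one_plus_minus_exp)
    from tendsto_add[OF this tendsto_exp_algebra[OF mN]]
    have "(\<lambda>k. (1 + N k) ^ m k) \<longlonglongrightarrow> exp (t *\<^sub>R A)" by simp
    then show ?thesis by (rule exp_mem_limit[rotated]) (intro power_mem mem)
  qed
  have "exp (t *\<^sub>R A) \<in> G" for t
  proof (cases "0 \<le> t")
    case False
    then show ?thesis using exp_minus_mem[OF pos[of "- t"]] by simp
  qed (rule pos)
  then show ?thesis by (simp add: generators_def)
qed

lemma zero_mem_generators: "0 \<in> generators"
  by (simp add: generators_def one)

lemma scaleR_mem_generators: "A \<in> generators \<Longrightarrow> c *\<^sub>R A \<in> generators"
  by (simp add: generators_def)

lemma exp_mem:
  assumes "A \<in> generators" shows "exp A \<in> G"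
proof -
  have "exp (1 *\<^sub>R A) \<in> G" using assms unfolding generators_def by blast
  then show ?thesis by simp
qed

text \<open>Apply the previous result to $1 + N_k = \exp(A/k)\exp(B/k)$, for which $kN_k \to A + B$.\<close>

lemma add_mem_generators:
  assumes A: "A \<in> generators" and B: "B \<in> generators"
  shows "A + B \<in> generators"
proof -
  define F where "F s = exp (s *\<^sub>R A) * exp (s *\<^sub>R B)" for s
  have "(F has_vector_derivative exp (0 *\<^sub>R A) * (exp (0 *\<^sub>R B) * B) + exp (0 *\<^sub>R A) * A * exp (0 *\<^sub>R B)) (at 0)"
    unfolding F_def[abs_def]
    by (rule has_vector_derivative_mult; rule exp_scaleR_has_vector_derivative_right)
  then have "((\<lambda>s. (F s - 1) /\<^sub>R s) \<longlongrightarrow> A + B) (at 0)"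
    unfolding has_vector_derivative_iff_quotient by (simp add: F_def add.commute)
  moreover have "filterlim (\<lambda>k. 1 / real (Suc k)) (at 0) sequentially"
    unfolding filterlim_at using LIMSEQ_Suc[OF lim_1_over_n] by auto
  ultimately have "(\<lambda>k. (F (1 / real (Suc k)) - 1) /\<^sub>R (1 / real (Suc k))) \<longlonglongrightarrow> A + B"
    by (rule filterlim_compose)
  then have lim: "(\<lambda>k. real (Suc k) *\<^sub>R (F (1 / real (Suc k)) - 1)) \<longlonglongrightarrow> A + B"
    by (simp add: divide_inverse)
  show ?thesis
  proof (rule limit_direction_mem_generators[OF _ _ _ lim])
    show "1 + (F (1 / real (Suc k)) - 1) \<in> G" for k
      using A B by (auto simp: F_def generators_def intro: mult)
    have "(\<lambda>k. (1 / real (Suc k)) *\<^sub>R (real (Suc k) *\<^sub>R (F (1 / real (Suc k)) - 1))) \<longlonglongrightarrow> 0 *\<^sub>R (A + B)"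
      by (intro tendsto_scaleR lim LIMSEQ_Suc[OF lim_1_over_n])
    then show "(\<lambda>k. F (1 / real (Suc k)) - 1) \<longlonglongrightarrow> 0" by simp
  qed simp
qed

lemma closed_generators: "closed generators"
  unfolding closed_sequential_limits
proof (intro allI impI, elim conjE)
  fix f :: "nat \<Rightarrow> 'a" and A
  assume f: "\<forall>n. f n \<in> generators" and lim: "f \<longlonglongrightarrow> A"
  have "exp (t *\<^sub>R A) \<in> G" for t
  proof (rule exp_mem_limit)
    show "exp (t *\<^sub>R f k) \<in> G" for k using f by (simp add: generators_def)
    show "(\<lambda>k. exp (t *\<^sub>R f k)) \<longlonglongrightarrow> exp (t *\<^sub>R A)"
      by (intro tendsto_exp_algebra tendsto_intros lim)
  qed
  then show "A \<in> generators" by (simp add: generators_def)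
qed

text \<open>To first order, replacing $A$ by $A + sW$ subtracts $sW$ from $\exp(-A)g - 1$; all other
  terms are small relative to $s$.\<close>

lemma exp_step_estimate:
  fixes A W g :: 'a
  assumes s: "0 \<le> s"
  shows "norm (exp (- (A + s *\<^sub>R W)) * g - 1) \<le>
    norm (exp (- A) * g - 1 - s *\<^sub>R W) + s * norm W *
      (norm (g - 1) + (exp (norm A + s * norm W) - 1) * norm g)"
proof -
  let ?r = "norm A + s * norm W"
  define D where "D = (exp (- (A + s *\<^sub>R W)) - (- (A + s *\<^sub>R W))) - (exp (- A) - (- A))"
  have "norm (- (A + s *\<^sub>R W)) \<le> ?r" "norm (- A) \<le> ?r"
    using norm_triangle_ineq[of A "s *\<^sub>R W"] s by (auto simp: algebra_simps norm_minus_commute[of "- A"])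
  from exp_minus_id_lipschitz[OF this] have D: "norm D \<le> (exp ?r - 1) * (s * norm W)"
    using s by (simp add: D_def)
  have tri: "norm (a + (- b + c)) \<le> norm a + (norm b + norm c)" for a b c :: 'a
    using norm_triangle_ineq[of a "- b + c"] norm_triangle_ineq[of "- b" c] by simp
  have E: "exp (- (A + s *\<^sub>R W)) = exp (- A) - s *\<^sub>R W + D" by (simp add: D_def)
  have "exp (- (A + s *\<^sub>R W)) * g - 1
      = (exp (- A) * g - 1 - s *\<^sub>R W) + (- (s *\<^sub>R (W * (g - 1))) + D * g)"
    unfolding E by (simp add: algebra_simps)
  also have "norm \<dots> \<le> norm (exp (- A) * g - 1 - s *\<^sub>R W) + (norm (s *\<^sub>R (W * (g - 1))) + norm (D * g))"
    by (rule tri)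
  also have "norm (s *\<^sub>R (W * (g - 1))) \<le> s * (norm W * norm (g - 1))"
    using s norm_mult_ineq[of W "g - 1"] by (simp add: mult_left_mono)
  also have "norm (D * g) \<le> (exp ?r - 1) * (s * norm W) * norm g"
    using norm_mult_ineq[of D g] mult_right_mono[OF D norm_ge_zero[of g]] by linarith
  finally show ?thesis by (simp add: algebra_simps)
qed

text \<open>Elements of the group near $1$ are exponentials of generators. Otherwise there are $g_k \to
  1$ in the group with $\log g_k$ not a generator. Let $A_k$ minimise $\|\exp(-A)g_k - 1\|$
  over the small generators $A$, and let $N_k \ne 0$ be the remainder $\exp(-A_k)g_k - 1$. A
  limit $W$ of $N_k / \|N_k\|$ is again a generator, and moving from $A_k$ to $A_k + \|N_k\|
  W$ reduces the remainder, contradicting minimality. The argument replaces a complement of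
  the Lie algebra and the inverse function theorem by compactness.\<close>

theorem log_series_mem_generators:
  "\<exists>\<rho>>0. \<rho> < 1 \<and> (\<forall>g\<in>G. norm (g - 1) < \<rho> \<longrightarrow> log_series (g - 1) \<in> generators)"
proof (rule ccontr)
  assume "\<not> ?thesis"
  then have neg: "\<exists>g\<in>G. norm (g - 1) < \<rho> \<and> log_series (g - 1) \<notin> generators" if "0 < \<rho>" "\<rho> < 1" for \<rho>
    using that by blast
  \<comment> \<open>Radius at most $1/3$ puts the logarithm of $g_k$ into the ball of radius $1/2$, where $\exp$ is injective.\<close>
  have "\<exists>g\<in>G. norm (g - 1) < 1 / real (k + 3) \<and> log_series (g - 1) \<notin> generators" for k
    by (rule neg) auto
  then have "\<forall>k. \<exists>g. g \<in> G \<and> norm (g - 1) < 1 / real (k + 3) \<and> log_series (g - 1) \<notin> generators"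
    by blast
  from choice[OF this] obtain g where g: "\<And>k. g k \<in> G" "\<And>k. norm (g k - 1) < 1 / real (k + 3)"
      "\<And>k. log_series (g k - 1) \<notin> generators"
    by blast
  have g1: "(\<lambda>k. norm (g k - 1)) \<longlonglongrightarrow> 0"
  proof (rule tendsto_sandwich[OF _ _ tendsto_const])
    show "(\<lambda>k. 1 / real (k + 3)) \<longlonglongrightarrow> 0" by (rule LIMSEQ_ignore_initial_segment[OF lim_1_over_n])
  qed (use g(2) in \<open>auto intro!: always_eventually less_imp_le\<close>)
  then have "(\<lambda>k. g k - 1) \<longlonglongrightarrow> 0" by (simp only: tendsto_norm_zero_iff)
  then have glim: "g \<longlonglongrightarrow> 1" by (simp only: LIM_zero_iff)
  define S where "S = generators \<inter> cball 0 (1 / 4)"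
  have "compact S" unfolding S_def by (intro closed_Int_compact closed_generators compact_cball)
  moreover have "S \<noteq> {}" using zero_mem_generators by (auto simp: S_def)
  moreover have "continuous_on S (\<lambda>A. norm (exp (- A) * g k - 1))" for k
    unfolding continuous_on_def by (intro ballI tendsto_intros tendsto_exp_algebra)
  ultimately have "\<exists>A\<in>S. \<forall>B\<in>S. norm (exp (- A) * g k - 1) \<le> norm (exp (- B) * g k - 1)" for k
    by (intro continuous_attains_inf)
  then have "\<forall>k. \<exists>A. A \<in> S \<and> (\<forall>B\<in>S. norm (exp (- A) * g k - 1) \<le> norm (exp (- B) * g k - 1))"
    by blast
  from choice[OF this] obtain A where A: "\<And>k. A k \<in> S"
    and min: "\<And>k B. B \<in> S \<Longrightarrow> norm (exp (- A k) * g k - 1) \<le> norm (exp (- B) * g k - 1)"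
    by blast
  have Agen: "A k \<in> generators" and Asmall: "norm (A k) \<le> 1 / 4" for k
    using A[of k] by (auto simp: S_def)
  define N where "N k = exp (- A k) * g k - 1" for k
  have NG: "1 + N k \<in> G" for k
    using exp_mem[OF scaleR_mem_generators[OF Agen, of "-1"]] g(1) by (simp add: N_def mult)
  have Nle: "norm (N k) \<le> norm (g k - 1)" for k
    using min[of 0 k] zero_mem_generators by (simp add: N_def S_def)
  have N0: "N \<longlonglongrightarrow> 0"
    by (rule Lim_null_comparison[OF always_eventually[OF allI[OF Nle]] g1])
  have Nnz: "N k \<noteq> 0" for k
  proof
    assume "N k = 0"
    then have "exp (A k) * (exp (- A k) * g k) = exp (A k)" by (simp add: N_def)
    then have gk: "g k = exp (A k)"
      by (simp add: mult.assoc[symmetric] exp_minus_inverse)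
    have small: "norm (g k - 1) \<le> 1 / 3"
      using g(2)[of k] by (rule order_trans[OF less_imp_le]) (simp add: divide_simps)
    have "norm (log_series (g k - 1) - log_series 0) \<le> norm (g k - 1 - 0) / (1 - 1 / 3)"
      by (rule log_series_lipschitz) (use small in auto)
    then have "norm (log_series (g k - 1)) \<le> 1 / 2" using small by simp
    moreover have "norm (A k) \<le> 1 / 2" using Asmall[of k] by simp
    moreover have "exp (log_series (g k - 1)) = exp (A k)"
      using exp_log_series[of "g k - 1"] small gk by simp
    ultimately have "log_series (g k - 1) = A k" by (rule exp_inj_small)
    then show False using g(3)[of k] Agen[of k] by simp
  qed
  have A0: "A \<longlonglongrightarrow> 0"
  proof (rule Lim_null_comparison)
    let ?c = "2 - exp (1 / 2 :: real)"
    show "\<forall>\<^sub>F k in sequentially. norm (A k) \<le> (exp (1 / 4) * norm (g k - 1) + norm (N k)) / ?c"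
    proof (intro always_eventually allI)
      fix k
      have "?c * norm (- A k - 0) \<le> norm (exp (- A k) - exp 0)"
        using Asmall[of k] by (intro norm_exp_diff_ge) auto
      also have "exp (- A k) - exp 0 = - (exp (- A k) * (g k - 1)) + N k"
        by (simp add: N_def algebra_simps)
      also have "norm \<dots> \<le> norm (exp (- A k) * (g k - 1)) + norm (N k)"
        using norm_triangle_ineq[of "- (exp (- A k) * (g k - 1))" "N k"] by simp
      also have "norm (exp (- A k) * (g k - 1)) \<le> exp (1 / 4) * norm (g k - 1)"
      proof -
        have "norm (exp (- A k)) \<le> exp (1 / 4)"
          using order_trans[OF norm_exp[of "- A k"], of "exp (1 / 4)"] Asmall[of k] by simp
        then show ?thesis
          by (rule order_trans[OF norm_mult_ineq mult_right_mono]) simp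
      qed
      finally show "norm (A k) \<le> (exp (1 / 4) * norm (g k - 1) + norm (N k)) / ?c"
        using exp_half_less_2 by (simp add: field_simps)
    qed
    have "(\<lambda>k. (exp (1 / 4) * norm (g k - 1) + norm (N k)) / ?c) \<longlonglongrightarrow> (exp (1 / 4) * 0 + norm (0::'a)) / ?c"
      using exp_half_less_2 by (intro tendsto_intros g1 N0) auto
    then show "(\<lambda>k. (exp (1 / 4) * norm (g k - 1) + norm (N k)) / ?c) \<longlonglongrightarrow> 0" by simp
  qed
  define V where "V k = inverse (norm (N k)) *\<^sub>R N k" for k
  have "norm (V k) \<le> 1" for k using Nnz by (simp add: V_def)
  then have "bounded (range V)" unfolding bounded_iff by blast
  then obtain W r where r: "strict_mono (r :: nat \<Rightarrow> nat)" and W: "(V \<circ> r) \<longlonglongrightarrow> W"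
    using bounded_imp_convergent_subsequence by blast
  have subseq: "(\<lambda>k. V (r k)) \<longlonglongrightarrow> W" "(\<lambda>k. norm (g (r k) - 1)) \<longlonglongrightarrow> 0"
      "(\<lambda>k. A (r k)) \<longlonglongrightarrow> 0" "(\<lambda>k. N (r k)) \<longlonglongrightarrow> 0" "(\<lambda>k. g (r k)) \<longlonglongrightarrow> 1"
    using W LIMSEQ_subseq_LIMSEQ[OF g1 r] LIMSEQ_subseq_LIMSEQ[OF A0 r]
      LIMSEQ_subseq_LIMSEQ[OF N0 r] LIMSEQ_subseq_LIMSEQ[OF glim r]
    by (simp_all only: o_def)
  have Wgen: "W \<in> generators"
  proof (rule limit_direction_mem_generators)
    show "(\<lambda>k. inverse (norm (N (r k))) *\<^sub>R N (r k)) \<longlonglongrightarrow> W"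
      using subseq(1) by (simp only: V_def)
    show "(\<lambda>k. N (r k)) \<longlonglongrightarrow> 0" by (rule subseq)
  qed (use NG in auto)
  define q where "q k = norm (V k - W) + norm W *
      (norm (g k - 1) + (exp (norm (A k) + norm (N k) * norm W) - 1) * norm (g k))" for k
  have q: "(\<lambda>k. q (r k)) \<longlonglongrightarrow> norm (W - W) + norm W *
      (0 + (exp (norm (0::'a) + norm (0::'a) * norm W) - 1) * norm (1::'a))"
    unfolding q_def by (intro tendsto_intros subseq)
  then have "\<forall>\<^sub>F k in sequentially. q (r k) < 1"
    by (rule order_tendstoD(2)) simp
  moreover have "\<forall>\<^sub>F k in sequentially. norm (A (r k) + norm (N (r k)) *\<^sub>R W) < 1 / 4"
  proof -
    have "(\<lambda>k. norm (A (r k) + norm (N (r k)) *\<^sub>R W)) \<longlonglongrightarrow> norm (0 + norm (0::'a) *\<^sub>R W)"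
      by (intro tendsto_intros subseq)
    then show ?thesis by (rule order_tendstoD(2)) simp
  qed
  ultimately have "\<forall>\<^sub>F k in sequentially. False"
  proof eventually_elim
    case (elim k)
    define j where "j = r k"
    have "A j + norm (N j) *\<^sub>R W \<in> S"
      using elim(2) by (simp add: S_def j_def add_mem_generators scaleR_mem_generators Agen Wgen)
    from min[OF this, of j]
    have "norm (N j) \<le> norm (exp (- (A j + norm (N j) *\<^sub>R W)) * g j - 1)" by (simp add: N_def)
    also have "\<dots> \<le> norm (N j - norm (N j) *\<^sub>R W) + norm (N j) * norm W *
      (norm (g j - 1) + (exp (norm (A j) + norm (N j) * norm W) - 1) * norm (g j))"
      unfolding N_def by (rule exp_step_estimate) simp
    also have "N j - norm (N j) *\<^sub>R W = norm (N j) *\<^sub>R (V j - W)"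
      using Nnz[of j] by (simp add: V_def scaleR_diff_right)
    also have "norm (norm (N j) *\<^sub>R (V j - W)) + norm (N j) * norm W *
      (norm (g j - 1) + (exp (norm (A j) + norm (N j) * norm W) - 1) * norm (g j)) = norm (N j) * q j"
      by (simp only: q_def norm_scaleR abs_norm_cancel) (simp add: algebra_simps)
    also have "\<dots> < norm (N j) * 1"
      using elim(1) Nnz[of j] by (intro mult_strict_left_mono) (auto simp: j_def)
    finally show False by simp
  qed
  then show False by simp
qed

end

section \<open>Square matrices as a Banach algebra\<close>

text \<open>A copy of the type of square matrices, to carry the matrix product and the operator norm.\<close>

typedef ('n::finite) sqmat = "UNIV :: (real^'n^'n) set"
  morphisms mat_of sqm by simp

declare sqm_inverse [simplified, simp] mat_of_inverse [simp]

instantiation sqmat :: (finite) real_normed_algebra_1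
begin

definition "0 = sqm 0"
definition "1 = sqm (mat 1)"
definition "x + y = sqm (mat_of x + mat_of y)"
definition "x - y = sqm (mat_of x - mat_of y)"
definition "- x = sqm (- mat_of x)"
definition "x * y = sqm (mat_of x ** mat_of y)"
definition "c *\<^sub>R x = sqm (c *\<^sub>R mat_of x)"
definition norm_sqmat_def: "norm x = matrix_norm (mat_of x)"
definition dist_sqmat_def: "dist x (y :: 'a sqmat) = norm (x - y)"
definition sgn_sqmat_def: "sgn x = inverse (norm x) *\<^sub>R (x :: 'a sqmat)"
definition uniformity_sqmat_def:
  "(uniformity :: ('a sqmat \<times> 'a sqmat) filter) = (INF e\<in>{0<..}. principal {(x, y). dist x y < e})"
definition open_sqmat_def:
  "open (U :: 'a sqmat set) \<longleftrightarrow> (\<forall>x\<in>U. \<forall>\<^sub>F (x', y) in uniformity. x' = x \<longrightarrow> y \<in> U)"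

lemmas sqmat_algebra_defs = zero_sqmat_def one_sqmat_def plus_sqmat_def minus_sqmat_def
  uminus_sqmat_def times_sqmat_def scaleR_sqmat_def

instance
proof
  fix x y z :: "'a sqmat" and a b :: real
  note bl = matrix_vector_mul_bounded_linear
  show "x + y + z = x + (y + z)" "x + y = y + x" "0 + x = x" "- x + x = 0" "x - y = x + - y"
    by (auto simp: sqmat_algebra_defs add_ac)
  show "x * y * z = x * (y * z)" by (simp add: sqmat_algebra_defs matrix_mul_assoc)
  show "(x + y) * z = x * z + y * z" "x * (y + z) = x * y + x * z"
    by (simp_all add: sqmat_algebra_defs matrix_add_ldistrib)
      (simp add: matrix_matrix_mult_def vec_eq_iff sqm_inject sum.distrib algebra_simps)
  show "a *\<^sub>R (x + y) = a *\<^sub>R x + a *\<^sub>R y" "(a + b) *\<^sub>R x = a *\<^sub>R x + b *\<^sub>R x"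
      "a *\<^sub>R b *\<^sub>R x = (a * b) *\<^sub>R x" "1 *\<^sub>R x = x"
    by (auto simp: sqmat_algebra_defs algebra_simps)
  show "a *\<^sub>R x * y = a *\<^sub>R (x * y)" "x * a *\<^sub>R y = a *\<^sub>R (x * y)"
    by (simp_all add: sqmat_algebra_defs scalar_matrix_assoc matrix_scalar_ac)
  show "1 * x = x" "x * 1 = x" by (auto simp: sqmat_algebra_defs)
  show "(0 :: 'a sqmat) \<noteq> 1"
    by (simp add: sqmat_algebra_defs sqm_inject mat_def vec_eq_iff)
  show "dist x y = norm (x - y)" by (rule dist_sqmat_def)
  show "sgn x = inverse (norm x) *\<^sub>R x" by (rule sgn_sqmat_def)
  show "(uniformity :: ('a sqmat \<times> 'a sqmat) filter) = (INF e\<in>{0<..}. principal {(x, y). dist x y < e})"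
    by (rule uniformity_sqmat_def)
  show "open U \<longleftrightarrow> (\<forall>x\<in>U. \<forall>\<^sub>F (x', y) in uniformity. x' = x \<longrightarrow> y \<in> U)" for U :: "'a sqmat set"
    by (rule open_sqmat_def)
  show "(norm x = 0) = (x = 0)"
    by (simp add: norm_sqmat_def matrix_norm_def onorm_eq_0[OF bl] zero_sqmat_def
        mat_of_inject[symmetric] matrix_eq)
  have "(*v) (mat_of x + mat_of y) = (\<lambda>v. mat_of x *v v + mat_of y *v v)"
    by (simp add: fun_eq_iff matrix_vector_mult_add_rdistrib)
  then show "norm (x + y) \<le> norm x + norm y"
    using onorm_triangle[OF bl bl, of "mat_of x" "mat_of y"]
    by (simp add: norm_sqmat_def matrix_norm_def plus_sqmat_def)
  have "(*v) (a *\<^sub>R mat_of x) = (\<lambda>v. a *\<^sub>R (mat_of x *v v))"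
    by (simp add: fun_eq_iff scaleR_matrix_vector_assoc)
  then show "norm (a *\<^sub>R x) = \<bar>a\<bar> * norm x"
    using onorm_scaleR[OF bl, of a "mat_of x"]
    by (simp add: norm_sqmat_def matrix_norm_def scaleR_sqmat_def)
  show "norm (x * y) \<le> norm x * norm y"
    using onorm_compose[OF bl bl, of "mat_of x" "mat_of y"]
    by (simp add: norm_sqmat_def matrix_norm_def times_sqmat_def o_def matrix_vector_mul_assoc)
  have "(*v) (mat 1 :: real^'a^'a) = (\<lambda>v. v)" by (simp add: fun_eq_iff)
  then show "norm (1 :: 'a sqmat) = 1"
    by (simp add: norm_sqmat_def matrix_norm_def one_sqmat_def onorm_id)
qed

end

lemma sqm_simps:
  "sqm 0 = 0" "sqm (mat 1) = 1" "sqm (A + B) = sqm A + sqm B" "sqm (A - B) = sqm A - sqm B"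
  "sqm (A ** B) = sqm A * sqm B" "sqm (c *\<^sub>R A) = c *\<^sub>R sqm A"
  by (simp_all add: sqmat_algebra_defs)

lemma mat_of_simps:
  "mat_of 0 = 0" "mat_of 1 = mat 1" "mat_of (x + y) = mat_of x + mat_of y"
  "mat_of (x - y) = mat_of x - mat_of y"
  "mat_of (x * y) = mat_of x ** mat_of y" "mat_of (c *\<^sub>R x) = c *\<^sub>R mat_of x"
  by (simp_all add: sqmat_algebra_defs)

lemma matrix_norm_eq: "matrix_norm A = norm (sqm A)"
  by (simp add: norm_sqmat_def)

lemma bounded_linear_mat_of: "bounded_linear mat_of"
proof (rule bounded_linear_intro)
  show "norm (mat_of x) \<le> norm x * (real CARD('a) * real CARD('a))" for x :: "'a::finite sqmat"
  proof -
    have "norm (mat_of x) \<le> (\<Sum>i\<in>UNIV. norm (mat_of x $ i))"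
      unfolding norm_vec_def by (rule L2_set_le_sum) simp
    also have "\<dots> \<le> (\<Sum>i\<in>(UNIV :: 'a set). \<Sum>j\<in>(UNIV :: 'a set). \<bar>mat_of x $ i $ j\<bar>)"
      by (intro sum_mono norm_le_l1_cart)
    also have "\<dots> \<le> (\<Sum>i\<in>(UNIV :: 'a set). \<Sum>j\<in>(UNIV :: 'a set). norm x)"
      unfolding norm_sqmat_def matrix_norm_def by (intro sum_mono matrix_component_le_onorm)
    finally show ?thesis by (simp add: mult_ac)
  qed
qed (simp_all add: mat_of_simps)

lemma bounded_linear_sqm: "bounded_linear sqm"
  unfolding linear_conv_bounded_linear[symmetric] by (intro linearI) (simp_all add: sqm_simps)

instance sqmat :: (finite) heine_borel
proof
  fix f :: "nat \<Rightarrow> 'a sqmat"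
  assume "bounded (range f)"
  then have "bounded (range (\<lambda>k. mat_of (f k)))"
    using bounded_linear_image[OF _ bounded_linear_mat_of, of "range f"] by (simp add: image_image)
  then obtain l r where r: "strict_mono (r :: nat \<Rightarrow> nat)" "((\<lambda>k. mat_of (f k)) \<circ> r) \<longlonglongrightarrow> l"
    using bounded_imp_convergent_subsequence by blast
  from bounded_linear.tendsto[OF bounded_linear_sqm this(2)]
  have "(f \<circ> r) \<longlonglongrightarrow> sqm l" by (simp add: o_def)
  with r(1) show "\<exists>l r. strict_mono (r :: nat \<Rightarrow> nat) \<and> (f \<circ> r) \<longlonglongrightarrow> l" by blast
qed

instance sqmat :: (finite) banach ..

lemma matrix_pow_eq: "matrix_pow A k = mat_of (sqm A ^ k)"
  unfolding matrix_pow_def by (induction k) (simp_all add: mat_of_simps)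

lemma matrix_exp_eq: "matrix_exp A = mat_of (exp (sqm A))"
proof -
  have "(\<lambda>k. mat_of (sqm A ^ k /\<^sub>R fact k)) sums mat_of (exp (sqm A))"
    by (rule bounded_linear.sums[OF bounded_linear_mat_of exp_converges])
  then show ?thesis
    unfolding matrix_exp_def by (simp add: sums_iff mat_of_simps matrix_pow_eq inverse_eq_divide)
qed

section \<open>Complex eigenvalues and the principal logarithm\<close>

definition complexify :: "'n::finite sqmat \<Rightarrow> complex^'n^'n" where
  "complexify x = map_matrix complex_of_real (mat_of x)"

lemma complexify_nth: "complexify x $ i $ j = complex_of_real (mat_of x $ i $ j)"
  by (simp add: complexify_def map_matrix_def)

lemma complexify_simps:
  "complexify 0 = 0" "complexify 1 = mat 1" "complexify (x + y) = complexify x + complexify y"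
  "complexify (x - y) = complexify x - complexify y"
  "complexify (x * y) = complexify x ** complexify y"
  by (simp_all add: vec_eq_iff complexify_nth mat_of_simps mat_def matrix_matrix_mult_def)

lemma complexify_mult_vec: "complexify (x * y) *v v = complexify x *v (complexify y *v v)"
  by (simp add: complexify_simps matrix_vector_mul_assoc)

lemma complex_eigenvalue_iff:
  "complex_eigenvalue A z \<longleftrightarrow> (\<exists>v. v \<noteq> 0 \<and> complexify (sqm A) *v v = z *s v)"
  by (simp add: complex_eigenvalue_def complexify_def)

lemma bounded_linear_complexify_vec: "bounded_linear (\<lambda>x. complexify x *v v)"
proof -
  have "bounded_linear (\<lambda>A. map_matrix complex_of_real A *v v)" for v :: "complex^'n"
    unfolding linear_conv_bounded_linear[symmetric]
    by (intro linearI)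
      (simp_all add: vec_eq_iff map_matrix_def matrix_vector_mult_def sum.distrib algebra_simps
        scaleR_sum_right, simp_all add: scaleR_conv_of_real mult_ac)
  from bounded_linear_compose[OF this bounded_linear_mat_of] show ?thesis
    by (simp add: complexify_def)
qed

lemma complexify_scaleR_vec: "complexify (c *\<^sub>R x) *v v = c *\<^sub>R (complexify x *v v)"
  using linear_scale[OF bounded_linear.linear[OF bounded_linear_complexify_vec]] .

lemma bounded_linear_complex_scale_vec: "bounded_linear (\<lambda>z. z *s (v :: complex^'n))"
  unfolding linear_conv_bounded_linear[symmetric]
  by (intro linearI) (simp_all add: vec_eq_iff algebra_simps)

lemma complexify_eq_0:
  assumes "\<And>v. complexify x *v v = 0"
  shows "x = 0"
proof -
  have "complexify x = 0" using assms by (simp add: matrix_eq)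
  then have "complex_of_real (mat_of x $ i $ j) = 0" for i j
    by (metis complexify_nth zero_index)
  then have "mat_of x = 0" by (simp add: vec_eq_iff)
  then show ?thesis by (metis mat_of_inverse sqm_simps(1))
qed

text \<open>The vector $p(M)w$.\<close>

definition poly_orbit :: "complex^'n^'n \<Rightarrow> complex poly \<Rightarrow> complex^'n \<Rightarrow> complex^'n" where
  "poly_orbit M p w = (\<Sum>i\<le>degree p. coeff p i *s (((*v) M) ^^ i) w)"

lemma poly_orbit_eq:
  assumes "degree p \<le> n"
  shows "poly_orbit M p w = (\<Sum>i\<le>n. coeff p i *s (((*v) M) ^^ i) w)"
  unfolding poly_orbit_def
  by (rule sum.mono_neutral_left) (use assms in \<open>auto simp: coeff_eq_0\<close>)

lemma poly_orbit_linear_factor: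
  "poly_orbit M ([:- z, 1:] * q) w = M *v poly_orbit M q w - z *s poly_orbit M q w"
proof -
  let ?I = "\<lambda>i. (((*v) M) ^^ i) w"
  let ?n = "degree q"
  have "degree ([:- z, 1:] * q) \<le> Suc ?n"
    using degree_mult_le[of "[:- z, 1:]" q] by simp
  then have "poly_orbit M ([:- z, 1:] * q) w = (\<Sum>i\<le>Suc ?n. coeff ([:- z, 1:] * q) i *s ?I i)"
    by (rule poly_orbit_eq)
  also have "\<dots> = (\<Sum>i\<le>Suc ?n. coeff (pCons 0 q) i *s ?I i - z *s (coeff q i *s ?I i))"
    by (intro sum.cong refl) (simp add: algebra_simps vec_eq_iff)
  also have "\<dots> = (\<Sum>i\<le>Suc ?n. coeff (pCons 0 q) i *s ?I i) - z *s (\<Sum>i\<le>Suc ?n. coeff q i *s ?I i)"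
    by (simp only: sum_subtractf vec.scale_sum_right)
  also have "(\<Sum>i\<le>Suc ?n. coeff q i *s ?I i) = poly_orbit M q w"
    by (rule poly_orbit_eq[symmetric]) simp
  also have "(\<Sum>i\<le>Suc ?n. coeff (pCons 0 q) i *s ?I i) = (\<Sum>i\<le>?n. coeff q i *s ?I (Suc i))"
    by (subst sum.atMost_Suc_shift) simp
  also have "\<dots> = M *v poly_orbit M q w"
    by (simp add: poly_orbit_def vector_scalar_commute linear_sum[OF matrix_vector_mul_linear])
  finally show ?thesis .
qed

lemma invariant_funpow:
  assumes "w \<in> S" "\<And>v. v \<in> S \<Longrightarrow> M *v v \<in> S"
  shows "(((*v) M) ^^ i) w \<in> S"
  by (induction i) (auto intro: assms)

lemma poly_orbit_mem:
  assumes S: "vec.subspace S" and inv: "\<And>v. v \<in> S \<Longrightarrow> M *v v \<in> S" and w: "w \<in> S"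
  shows "poly_orbit M p w \<in> S"
  unfolding poly_orbit_def
  by (intro vec.subspace_sum vec.subspace_scale S invariant_funpow[where S = S] w inv)

text \<open>The vectors $M^i w$, with $i$ up to the real dimension of the space, are too many to be
  independent over the reals. A coincidence $M^i w = M^j w$ is treated separately, as it
  shrinks the set of vectors.\<close>

lemma annihilating_poly:
  fixes M :: "complex^'n^'n"
  shows "\<exists>p. p \<noteq> 0 \<and> poly_orbit M p w = 0"
proof -
  define I where "I i = (((*v) M) ^^ i) w" for i
  define n where "n = DIM(complex^'n)"
  show ?thesis
  proof (cases "inj_on I {..n}")
    case False
    then obtain i j where ij: "i \<noteq> j" "I i = I j" by (auto simp: inj_on_def)
    define p where "p = monom (1::complex) i - monom 1 j"
    have "degree p \<le> max i j"
      unfolding p_def by (rule degree_diff_le) (auto intro: order_trans[OF degree_monom_le])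
    then have "poly_orbit M p w = (\<Sum>k\<le>max i j. coeff p k *s I k)"
      unfolding I_def by (rule poly_orbit_eq)
    also have "\<dots> = (\<Sum>k\<le>max i j. (if k = i then I k else 0) - (if k = j then I k else 0))"
      by (intro sum.cong refl) (auto simp: p_def vec_eq_iff)
    also have "\<dots> = I i - I j" by (simp add: sum_subtractf)
    finally have "poly_orbit M p w = 0" using ij by simp
    moreover have "coeff p i \<noteq> 0" using ij by (simp add: p_def)
    then have "p \<noteq> 0" by auto
    ultimately show ?thesis by blast
  next
    case True
    have "card (I ` {..n}) = Suc n" using True by (simp add: card_image)
    then have "dependent (I ` {..n})"
      using independent_card_le[of "I ` {..n}"] by (auto simp: n_def)
    then obtain u where u: "\<exists>v\<in>I ` {..n}. u v \<noteq> 0" "(\<Sum>v\<in>I ` {..n}. u v *\<^sub>R v) = 0"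
      by (subst (asm) dependent_finite) auto
    define p where "p = (\<Sum>i\<le>n. monom (complex_of_real (u (I i))) i)"
    have cp: "coeff p k = (if k \<le> n then complex_of_real (u (I k)) else 0)" for k
      by (simp add: p_def coeff_sum)
    have "degree p \<le> n" by (rule degree_le) (simp add: cp)
    then have "poly_orbit M p w = (\<Sum>k\<le>n. coeff p k *s I k)"
      unfolding I_def by (rule poly_orbit_eq)
    also have "\<dots> = (\<Sum>k\<le>n. u (I k) *\<^sub>R I k)"
      by (intro sum.cong refl) (simp add: cp vec_eq_iff, simp add: scaleR_conv_of_real)
    also have "\<dots> = (\<Sum>v\<in>I ` {..n}. u v *\<^sub>R v)"
      using sum.reindex[OF True, of "\<lambda>v. u v *\<^sub>R v"] by (simp add: o_def)
    finally have "poly_orbit M p w = 0" using u(2) by simp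
    moreover obtain k where "k \<le> n" "u (I k) \<noteq> 0" using u(1) by auto
    then have "coeff p k \<noteq> 0" by (simp add: cp)
    then have "p \<noteq> 0" by auto
    ultimately show ?thesis by blast
  qed
qed

text \<open>A polynomial $p \ne 0$ with $p(M)w = 0$ has a root $z$, and $p = (X - z)q$. Either $q(M)w$
  is an eigenvector for $z$, or $q$ is an annihilating polynomial of smaller degree.\<close>

lemma invariant_subspace_eigenvector:
  fixes M :: "complex^'n^'n"
  assumes S: "vec.subspace S" and inv: "\<And>v. v \<in> S \<Longrightarrow> M *v v \<in> S" and w: "w \<in> S" "w \<noteq> 0"
  obtains v z where "v \<in> S" "v \<noteq> 0" "M *v v = z *s v"
proof -
  have "\<exists>v\<in>S. v \<noteq> 0 \<and> (\<exists>z. M *v v = z *s v)" if "p \<noteq> 0" "poly_orbit M p w = 0" for p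
    using that
  proof (induction "degree p" arbitrary: p rule: less_induct)
    case less
    show ?case
    proof (cases "degree p = 0")
      case True
      then obtain c where "p = [:c:]" by (rule degree_eq_zeroE)
      with less.prems w(2) show ?thesis by (simp add: poly_orbit_def)
    next
      case False
      then obtain z where "poly p z = 0"
        using fundamental_theorem_of_algebra[of p] by (auto simp: constant_degree)
      then obtain q where q: "p = [:- z, 1:] * q" by (auto simp: poly_eq_0_iff_dvd)
      have "q \<noteq> 0" using q less.prems(1) by auto
      then have deg: "degree q < degree p" unfolding q by (subst degree_mult_eq) auto
      show ?thesis
      proof (cases "poly_orbit M q w = 0")
        case True
        with less.hyps[OF deg \<open>q \<noteq> 0\<close>] show ?thesis by blast
      next
        case nz: False
        have "M *v poly_orbit M q w = z *s poly_orbit M q w"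
          using less.prems(2) unfolding q poly_orbit_linear_factor by simp
        moreover have "poly_orbit M q w \<in> S" by (rule poly_orbit_mem[OF S inv w(1)])
        ultimately show ?thesis using nz by blast
      qed
    qed
  qed
  with annihilating_poly[of M w] that show ?thesis by blast
qed

lemma subspace_eigenspace:
  assumes "vec.subspace S"
  shows "vec.subspace {v \<in> S. M *v v = z *s (v :: complex^'n)}"
  using assms unfolding vec.subspace_def
  by (auto simp: matrix_vector_right_distrib vector_scalar_commute algebra_simps vec.scale_right_distrib)

text \<open>The eigenspaces of $M$ in $S$ are invariant under every map that commutes with $M$.\<close>

lemma common_eigenvector:
  fixes M P :: "complex^'n^'n"
  assumes S: "vec.subspace S" and invM: "\<And>v. v \<in> S \<Longrightarrow> M *v v \<in> S"
    and invP: "\<And>v. v \<in> S \<Longrightarrow> P *v v \<in> S" and comm: "M ** P = P ** M"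
    and w: "w \<in> S" "w \<noteq> 0"
  obtains v y z where "v \<in> S" "v \<noteq> 0" "M *v v = y *s v" "P *v v = z *s v"
proof -
  obtain v y where v: "v \<in> S" "v \<noteq> 0" "M *v v = y *s v"
    using invariant_subspace_eigenvector[OF S invM w] by blast
  define E where "E = {v \<in> S. M *v v = y *s v}"
  have E: "vec.subspace E" unfolding E_def by (rule subspace_eigenspace[OF S])
  have inv: "P *v v \<in> E" if "v \<in> E" for v
  proof -
    have "M *v (P *v v) = P *v (M *v v)" using comm by (simp add: matrix_vector_mul_assoc)
    also have "\<dots> = y *s (P *v v)" using that by (simp add: E_def vector_scalar_commute)
    finally show ?thesis using that invP by (simp add: E_def)
  qed
  have "v \<in> E" using v by (simp add: E_def)
  then obtain v' z where "v' \<in> E" "v' \<noteq> 0" "P *v v' = z *s v'"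
    using invariant_subspace_eigenvector[OF E inv _ v(2)] by blast
  then show thesis using that by (auto simp: E_def)
qed

lemma eigenvalue_power:
  assumes "complexify x *v v = z *s v"
  shows "complexify (x ^ k) *v v = z ^ k *s v"
proof (induction k)
  case (Suc k)
  have "complexify (x ^ Suc k) *v v = complexify x *v (complexify (x ^ k) *v v)"
    by (simp add: complexify_mult_vec)
  also have "\<dots> = z ^ k *s (complexify x *v v)" by (simp add: Suc vector_scalar_commute)
  finally show ?case by (simp add: assms mult.commute)
qed (simp add: complexify_simps)

text \<open>Stated for a sequence of coefficients, to cover both $\exp$ and the logarithm.\<close>

lemma eigenvalue_power_series:
  assumes eig: "complexify x *v v = z *s v"
    and x: "(\<lambda>k. c k *\<^sub>R x ^ k) sums y"
    and z: "(\<lambda>k. c k *\<^sub>R z ^ k) sums \<mu>"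
  shows "complexify y *v v = \<mu> *s v"
proof -
  have "complexify (c k *\<^sub>R x ^ k) *v v = (c k *\<^sub>R z ^ k) *s v" for k
    by (simp add: complexify_scaleR_vec eigenvalue_power[OF eig])
      (simp add: vec_eq_iff)
  then have "(\<lambda>k. (c k *\<^sub>R z ^ k) *s v) sums (complexify y *v v)"
    using bounded_linear.sums[OF bounded_linear_complexify_vec x, of v] by simp
  moreover have "(\<lambda>k. (c k *\<^sub>R z ^ k) *s v) sums (\<mu> *s v)"
    by (rule bounded_linear.sums[OF bounded_linear_complex_scale_vec z])
  ultimately show ?thesis by (rule sums_unique2)
qed

text \<open>If $xv = zv$, then $z^k v = x^k v \to 0$, as $\|x^k\| \to 0$.\<close>

lemma eigenvalue_norm_less_1:
  fixes x :: "'n::finite sqmat"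
  assumes x: "norm x < 1" and eig: "complexify x *v v = z *s v" and v: "v \<noteq> 0"
  shows "norm z < 1"
proof (rule ccontr)
  assume "\<not> norm z < 1"
  then have ge: "norm (z ^ k) \<ge> 1" for k by (simp add: norm_power)
  obtain i where i: "v $ i \<noteq> 0" using v by (auto simp: vec_eq_iff)
  have "(\<lambda>k. x ^ k) \<longlonglongrightarrow> 0"
    by (rule Lim_null_comparison[OF _ LIMSEQ_power_zero[of "norm x"]])
      (use x in \<open>auto intro!: always_eventually norm_power_ineq\<close>)
  from bounded_linear.tendsto[OF bounded_linear_complexify_vec[of v] this]
  have "(\<lambda>k. z ^ k *s v) \<longlonglongrightarrow> 0" by (simp add: eigenvalue_power[OF eig] complexify_simps)
  from tendsto_vec_nth[OF this, of i] have "(\<lambda>k. z ^ k * v $ i) \<longlonglongrightarrow> 0" by simp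
  from tendsto_mult[OF this tendsto_const[of "inverse (v $ i)"]]
  have "(\<lambda>k. z ^ k) \<longlonglongrightarrow> 0" using i by (simp add: mult.assoc)
  then have "(\<lambda>k. norm (z ^ k)) \<longlonglongrightarrow> 0" by (rule tendsto_norm_zero)
  then have "1 \<le> (0::real)" by (rule LIMSEQ_le_const) (use ge in auto)
  then show False by simp
qed

lemma eigenvalue_exp:
  assumes "complexify x *v v = z *s v"
  shows "complexify (exp x) *v v = exp z *s v"
  by (rule eigenvalue_power_series[OF assms, where c = "\<lambda>k. inverse (fact k)"]) (rule exp_converges)+

text \<open>The eigenspace of $\log(1+x)$ for $z$ is invariant under $x$, hence contains an eigenvector
  of $x$, with an eigenvalue $y$ in the unit disc. Therefore $z = \mathrm{Ln}(1+y)$, and $1 +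
  y$ lies in the right half plane.\<close>

lemma log_series_eigenvalue_Im:
  fixes x :: "'n::finite sqmat"
  assumes x: "norm x < 1" and eig: "complexify (log_series x) *v v = z *s v" and v: "v \<noteq> 0"
  shows "\<bar>Im z\<bar> < pi / 2"
proof -
  have "x * log_series x = log_series x * x" by (rule commute_log_series[OF x]) simp
  then have comm: "complexify (log_series x) ** complexify x = complexify x ** complexify (log_series x)"
    by (metis complexify_simps(5))
  define S where "S = {v \<in> UNIV. complexify (log_series x) *v v = z *s v}"
  have S: "vec.subspace S" unfolding S_def by (rule subspace_eigenspace) simp
  have inv: "complexify x *v u \<in> S" if "u \<in> S" for u
  proof -
    have "complexify (log_series x) *v (complexify x *v u)
        = complexify x *v (complexify (log_series x) *v u)"
      using comm by (simp add: matrix_vector_mul_assoc)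
    then show ?thesis using that by (simp add: S_def vector_scalar_commute)
  qed
  have "v \<in> S" using eig by (simp add: S_def)
  from invariant_subspace_eigenvector[OF S inv this v]
  obtain u y where u: "u \<in> S" "u \<noteq> 0" "complexify x *v u = y *s u" by blast
  have y: "norm y < 1" by (rule eigenvalue_norm_less_1[OF x u(3,2)])
  have "(-1) ^ Suc k / of_nat k * y ^ k = ((-1) ^ Suc k / real k) *\<^sub>R y ^ k" for k
    by (simp add: scaleR_conv_of_real)
  then have "(\<lambda>k. ((-1) ^ Suc k / real k) *\<^sub>R y ^ k) sums ln (1 + y)"
    using Ln_series[OF y] by simp
  then have "complexify (log_series x) *v u = ln (1 + y) *s u"
    by (rule eigenvalue_power_series[OF u(3) log_series_sums[OF x]])
  then have "z *s u = ln (1 + y) *s u" using u(1) by (auto simp: S_def)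
  then have "z = ln (1 + y)" using u(2) by (simp only: vec.scale_cancel_right) simp
  moreover have "0 < Re (1 + y)" using y complex_Re_le_cmod[of "- y"] by simp
  ultimately show ?thesis
    using Re_Ln_pos_lt_imp by simp
qed

text \<open>Let $L$ be the log series and $M = A - L$. As $A$ commutes with $\exp A = 1 + x$, it
  commutes with $x$ and $L$, so $\exp M = 1$. If $M \ne 0$, its range $R$ is a nonzero
  subspace invariant under $A$ and $L$ and contains a common eigenvector $v$. The eigenvalue
  of $M$ at $v$ is a multiple of $2\pi i$ with imaginary part of modulus less than $\pi +
  \pi/2$, hence $0$. Writing $v = Mu$ gives $M^2 u = 0$ and $u = \exp(M)u = u + v$, so $v =
  0$.\<close>

theorem principal_log_unique:
  fixes A x :: "'n::finite sqmat"
  assumes x: "norm x < 1" and A: "exp A = 1 + x"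
    and strip: "\<And>v z. v \<noteq> 0 \<Longrightarrow> complexify A *v v = z *s v \<Longrightarrow> - pi < Im z \<and> Im z < pi"
  shows "A = log_series x"
proof (rule ccontr)
  define L where "L = log_series x"
  define M where "M = A - L"
  assume "A \<noteq> log_series x"
  then have "M \<noteq> 0" by (simp add: M_def L_def)
  have "exp A * A = A * exp A" using exp_times_scaleR_commute[of 1 A] by simp
  then have "A * x = x * A" unfolding A by (simp add: algebra_simps)
  then have comm: "A * L = L * A" unfolding L_def by (rule commute_log_series[OF x])
  have "exp M = exp (A + - L)" by (simp add: M_def)
  also have "\<dots> = exp A * exp (- L)" by (rule exp_add_commuting) (simp add: comm)
  also have "\<dots> = 1" unfolding A L_def using exp_log_series[OF x] by (metis exp_minus_inverse)
  finally have expM: "exp M = 1" .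
  obtain w where w: "complexify M *v w \<noteq> 0" using complexify_eq_0[of M] \<open>M \<noteq> 0\<close> by blast
  define R where "R = range (\<lambda>v. complexify M *v v)"
  have R: "vec.subspace R"
    unfolding vec.subspace_def R_def
    by (auto simp: image_iff matrix_vector_right_distrib[symmetric] vector_scalar_commute[symmetric]
        intro: exI[of _ "0 :: complex^'n"])
  have comm': "A * M = M * A" "L * M = M * L" by (simp_all add: M_def algebra_simps comm)
  have inv: "complexify B *v v \<in> R" if B: "B * M = M * B" and v: "v \<in> R" for B v
  proof -
    obtain u where "v = complexify M *v u" using v by (auto simp: R_def)
    then have "complexify B *v v = complexify M *v (complexify B *v u)"
      using B by (metis complexify_mult_vec)
    then show ?thesis by (simp add: R_def)
  qed
  have "complexify A ** complexify L = complexify L ** complexify A"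
    using comm by (metis complexify_simps(5))
  moreover have "complexify M *v w \<in> R" by (simp add: R_def)
  ultimately obtain v \<alpha> \<nu> where v: "v \<in> R" "v \<noteq> 0"
      "complexify A *v v = \<alpha> *s v" "complexify L *v v = \<nu> *s v"
    using common_eigenvector[OF R inv[OF comm'(1)] inv[OF comm'(2)] _ _ w] by blast
  define \<mu> where "\<mu> = \<alpha> - \<nu>"
  have Mv: "complexify M *v v = \<mu> *s v"
    by (simp add: M_def \<mu>_def complexify_simps matrix_vector_mult_diff_rdistrib v vec_eq_iff algebra_simps)
  from eigenvalue_exp[OF this] have "exp \<mu> *s v = 1 *s v" by (simp add: expM complexify_simps)
  then have "exp \<mu> = 1" using v(2) by (simp only: vec.scale_cancel_right) simp
  then obtain n :: int where n: "Re \<mu> = 0" "Im \<mu> = of_int (2 * n) * pi"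
    unfolding exp_eq_1 by blast
  have "- pi < Im \<alpha>" "Im \<alpha> < pi" using strip[OF v(2,3)] by auto
  moreover have "\<bar>Im \<nu>\<bar> < pi / 2" using log_series_eigenvalue_Im[OF x _ v(2)] v(4) by (simp add: L_def)
  ultimately have "\<bar>Im \<mu>\<bar> < 2 * pi" by (simp add: \<mu>_def)
  then have "\<bar>2 * pi * of_int n\<bar> < 2 * pi * 1" by (simp add: n(2) mult_ac)
  then have "\<bar>real_of_int n\<bar> < 1" by (simp add: abs_mult)
  then have "n = 0" by linarith
  then have "\<mu> = 0" using n by (simp add: complex_eq_iff)
  then have Mv0: "complexify M *v v = 0" using Mv by simp
  obtain u where u: "v = complexify M *v u" using v(1) by (auto simp: R_def)
  have "(\<lambda>k. complexify (M ^ k /\<^sub>R fact k) *v u) sums (complexify (exp M) *v u)"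
    by (rule bounded_linear.sums[OF bounded_linear_complexify_vec exp_converges])
  moreover have "(\<lambda>k. complexify (M ^ k /\<^sub>R fact k) *v u) sums
      (\<Sum>k<2. complexify (M ^ k /\<^sub>R fact k) *v u)"
  proof (rule sums_finite)
    fix k :: nat assume "k \<notin> {..<2}"
    then obtain j where j: "k = j + 2" by (metis add.commute le_Suc_ex lessThan_iff not_less)
    have "complexify (M ^ k) *v u = complexify (M ^ j) *v (complexify M *v (complexify M *v u))"
      by (simp only: j power_add power2_eq_square complexify_mult_vec)
    also have "\<dots> = 0" using Mv0 u by simp
    finally show "complexify (M ^ k /\<^sub>R fact k) *v u = 0"
      by (simp add: complexify_scaleR_vec)
  qed simp
  ultimately have "complexify (exp M) *v u = (\<Sum>k<2. complexify (M ^ k /\<^sub>R fact k) *v u)"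
    by (rule sums_unique2)
  also have "\<dots> = u + v" by (simp add: numeral_2_eq_2 complexify_simps u)
  finally have "v = 0" by (simp add: expM complexify_simps)
  with v(2) show False by simp
qed

text \<open>The link between the abstract characterisation of the principal logarithm and its power
  series; it is what makes the definite description meaningful on the unit ball.\<close>

theorem matrix_log_eq:
  assumes "norm (sqm X - 1) < 1"
  shows "matrix_log X = mat_of (log_series (sqm X - 1))"
  unfolding matrix_log_def
proof (rule the_equality)
  let ?L = "log_series (sqm X - 1)"
  have "matrix_exp (mat_of ?L) = X" using exp_log_series[OF assms] by (simp add: matrix_exp_eq)
  moreover have "- pi < Im z \<and> Im z < pi" if "complex_eigenvalue (mat_of ?L) z" for z
    using that log_series_eigenvalue_Im[OF assms] pi_gt_zero
    by (fastforce simp: complex_eigenvalue_iff)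
  ultimately show "matrix_exp (mat_of ?L) = X \<and>
      (\<forall>z. complex_eigenvalue (mat_of ?L) z \<longrightarrow> - pi < Im z \<and> Im z < pi)" by blast
next
  fix A :: "real^'a^'a"
  assume A: "matrix_exp A = X \<and> (\<forall>z. complex_eigenvalue A z \<longrightarrow> - pi < Im z \<and> Im z < pi)"
  have "sqm A = log_series (sqm X - 1)"
  proof (rule principal_log_unique[OF assms])
    have "sqm (matrix_exp A) = sqm X" using A by simp
    then show "exp (sqm A) = 1 + (sqm X - 1)" by (simp add: matrix_exp_eq)
    show "- pi < Im z \<and> Im z < pi" if "v \<noteq> 0" "complexify (sqm A) *v v = z *s v" for v z
      using A that by (auto simp: complex_eigenvalue_iff)
  qed
  then show "A = mat_of (log_series (sqm X - 1))" by (metis sqm_inverse UNIV_I)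
qed

lemma log_domain_unit_ball:
  assumes "norm (sqm X - 1) < 1"
  shows "X \<in> log_domain"
  unfolding log_domain_def
proof (intro CollectI allI impI notI)
  fix x :: real
  assume "x \<le> 0" "complex_eigenvalue X (complex_of_real x)"
  then obtain v where v: "v \<noteq> 0" "complexify (sqm X) *v v = complex_of_real x *s v"
    by (auto simp: complex_eigenvalue_iff)
  then have "complexify (sqm X - 1) *v v = complex_of_real (x - 1) *s v"
    by (simp add: complexify_simps matrix_vector_mult_diff_rdistrib vec_eq_iff algebra_simps)
  from eigenvalue_norm_less_1[OF assms this v(1)] \<open>x \<le> 0\<close> show False
    by (simp only: norm_of_real)
qed

section \<open>The error dynamics\<close>

text \<open>For $E_0$ in the unit ball around $1$ this is $E_0^s$ with $s = e^{-a(t-t_0)}$, the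
  candidate for the error at time $t$.\<close>

definition error_flow :: "real \<Rightarrow> real \<Rightarrow> 'a \<Rightarrow> real \<Rightarrow> 'a::{real_normed_algebra_1,banach}" where
  "error_flow a t0 E0 t = exp (exp (- a * (t - t0)) *\<^sub>R log_series (E0 - 1))"

lemma error_flow_init:
  "norm (E0 - 1) < 1 \<Longrightarrow> error_flow a t0 E0 t0 = E0"
  by (simp add: error_flow_def exp_log_series)

lemma error_flow_bounds:
  fixes E0 :: "'a::{real_normed_algebra_1,banach}"
  assumes E0: "norm (E0 - 1) < 1" and t: "t0 \<le> t" and a: "0 < a"
  shows "norm (error_flow a t0 E0 t - 1) < 1"
    and "norm (error_flow a t0 E0 t - 1) \<le> - ln (1 - norm (E0 - 1)) * exp (- a * (t - t0))"
proof -
  define s where "s = exp (- a * (t - t0))"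
  have s: "0 \<le> s" "s \<le> 1" using a t by (auto simp: s_def)
  have le: "norm (error_flow a t0 E0 t - 1) \<le> 1 - exp (s * ln (1 - norm (E0 - 1)))"
    unfolding error_flow_def s_def[symmetric] by (rule norm_exp_scaleR_log_series[OF E0 s])
  then show "norm (error_flow a t0 E0 t - 1) < 1"
    using exp_gt_zero[of "s * ln (1 - norm (E0 - 1))"] by linarith
  show "norm (error_flow a t0 E0 t - 1) \<le> - ln (1 - norm (E0 - 1)) * exp (- a * (t - t0))"
  proof -
    have "1 - exp (s * ln (1 - norm (E0 - 1))) \<le> - (s * ln (1 - norm (E0 - 1)))"
      using exp_ge_add_one_self[of "s * ln (1 - norm (E0 - 1))"] by linarith
    with le show ?thesis by (simp add: s_def mult.commute)
  qed
qed

text \<open>Scaling by a factor in $(0,1]$ keeps the spectrum of the logarithm inside the strip, so the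
  scaled matrix is still principal.\<close>

lemma log_series_error_flow:
  fixes E0 :: "'n::finite sqmat"
  assumes E0: "norm (E0 - 1) < 1" and t: "t0 \<le> t" and a: "0 < a"
  shows "log_series (error_flow a t0 E0 t - 1) = exp (- a * (t - t0)) *\<^sub>R log_series (E0 - 1)"
proof (rule principal_log_unique[symmetric])
  define s where "s = exp (- a * (t - t0))"
  have s: "0 < s" "s \<le> 1" using a t by (auto simp: s_def)
  show "norm (error_flow a t0 E0 t - 1) < 1" by (rule error_flow_bounds[OF assms])
  show "exp (exp (- a * (t - t0)) *\<^sub>R log_series (E0 - 1)) = 1 + (error_flow a t0 E0 t - 1)"
    by (simp add: error_flow_def)
  fix v z assume v: "v \<noteq> 0" and eig: "complexify (exp (- a * (t - t0)) *\<^sub>R log_series (E0 - 1)) *v v = z *s v"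
  have "complexify (log_series (E0 - 1)) *v v = inverse s *\<^sub>R (s *\<^sub>R (complexify (log_series (E0 - 1)) *v v))"
    using s(1) by simp
  also have "s *\<^sub>R (complexify (log_series (E0 - 1)) *v v) = z *s v"
    using eig by (simp only: complexify_scaleR_vec s_def)
  also have "inverse s *\<^sub>R (z *s v) = (inverse s *\<^sub>R z) *s v" by (simp add: vec_eq_iff)
  finally have "\<bar>Im (inverse s *\<^sub>R z)\<bar> < pi / 2"
    by (rule log_series_eigenvalue_Im[OF E0 _ v])
  then have "\<bar>Im z\<bar> / s < pi / 2" using s(1) by (simp add: abs_mult field_simps)
  then have "\<bar>Im z\<bar> < pi / 2 * s" using s(1) by (simp add: pos_divide_less_eq)
  also have "\<dots> \<le> pi / 2 * 1" using s by (intro mult_left_mono) auto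
  finally show "- pi < Im z \<and> Im z < pi" using pi_gt_zero by linarith
qed

lemma error_flow_has_vector_derivative:
  fixes E0 :: "'n::finite sqmat"
  assumes E0: "norm (E0 - 1) < 1" and t: "t0 \<le> t" and a: "0 < a"
  shows "(error_flow a t0 E0 has_vector_derivative
    - a *\<^sub>R (error_flow a t0 E0 t * log_series (error_flow a t0 E0 t - 1))) (at t within S)"
proof -
  let ?s = "\<lambda>t. exp (- a * (t - t0))" and ?L = "log_series (E0 - 1)"
  have "(?s has_real_derivative - a * ?s t) (at t within S)"
    by (auto intro!: derivative_eq_intros)
  then have "(?s has_vector_derivative - a * ?s t) (at t within S)"
    by (simp only: has_real_derivative_iff_has_vector_derivative)
  from vector_diff_chain_within[OF this
      has_vector_derivative_at_within[OF exp_scaleR_has_vector_derivative_right[of ?L]]]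
  have "(error_flow a t0 E0 has_vector_derivative (- a * ?s t) *\<^sub>R (exp (?s t *\<^sub>R ?L) * ?L)) (at t within S)"
    by (simp only: o_def error_flow_def[abs_def])
  moreover have "(- a * ?s t) *\<^sub>R (exp (?s t *\<^sub>R ?L) * ?L) =
      - a *\<^sub>R (error_flow a t0 E0 t * log_series (error_flow a t0 E0 t - 1))"
    unfolding log_series_error_flow[OF assms] by (simp add: error_flow_def)
  ultimately show ?thesis by simp
qed

text \<open>Stated with the principal logarithm itself, because an observer solution is confined to the
  unit ball only after it has been identified with the explicit one.\<close>

definition error_field :: "real \<Rightarrow> 'n::finite sqmat \<Rightarrow> 'n sqmat" where
  "error_field a E = - a *\<^sub>R (E * sqm (matrix_log (mat_of E)))"

lemma error_field_unit_ball:
  "norm (E - 1) < 1 \<Longrightarrow> error_field a E = - a *\<^sub>R (E * log_series (E - 1))"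
  by (simp add: error_field_def matrix_log_eq)

lemma error_field_locally_lipschitz:
  fixes E :: "'n::finite sqmat"
  assumes E: "norm (E - 1) < 1"
  shows "\<exists>e>0. \<exists>C. \<forall>p\<in>ball E e. \<forall>q\<in>ball E e.
    norm (error_field a p - error_field a q) \<le> C * norm (p - q)"
proof -
  define r where "r = (1 + norm (E - 1)) / 2"
  have r: "0 < r" "r < 1" using E by (auto simp: r_def add_pos_nonneg)
  have near: "norm (p - 1) \<le> r" if "p \<in> ball E (1 - r)" for p
    using that norm_triangle_ineq[of "p - E" "E - 1"]
    by (auto simp: dist_norm norm_minus_commute r_def field_simps)
  have "norm (error_field a p - error_field a q) \<le> (\<bar>a\<bar> * (3 / (1 - r))) * norm (p - q)"
    if p: "p \<in> ball E (1 - r)" and q: "q \<in> ball E (1 - r)" for p q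
  proof -
    let ?l = "\<lambda>p. log_series (p - 1)"
    have "norm p \<le> 2" using norm_triangle_ineq[of "p - 1" 1] near[OF p] r by simp
    have lpq: "norm (?l p - ?l q) \<le> norm (p - q) / (1 - r)"
      using log_series_lipschitz[OF near[OF p] near[OF q] r(2)] by simp
    have "norm (?l q) \<le> norm (q - 1) / (1 - r)"
      using log_series_lipschitz[OF near[OF q], of 0] r by simp
    also have "\<dots> \<le> 1 / (1 - r)" using near[OF q] r by (intro divide_right_mono) auto
    finally have lq: "norm (?l q) \<le> 1 / (1 - r)" .
    have "error_field a p - error_field a q = - a *\<^sub>R (p * (?l p - ?l q) + (p - q) * ?l q)"
      using near[OF p] near[OF q] r by (simp add: error_field_unit_ball algebra_simps)
    then have "norm (error_field a p - error_field a q) = \<bar>a\<bar> * norm (p * (?l p - ?l q) + (p - q) * ?l q)"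
      by simp
    also have "\<dots> \<le> \<bar>a\<bar> * (2 * (norm (p - q) / (1 - r)) + norm (p - q) * (1 / (1 - r)))"
    proof (intro mult_left_mono norm_triangle_le add_mono)
      show "norm (p * (?l p - ?l q)) \<le> 2 * (norm (p - q) / (1 - r))"
        by (rule order_trans[OF norm_mult_ineq mult_mono]) (use \<open>norm p \<le> 2\<close> lpq in auto)
      show "norm ((p - q) * ?l q) \<le> norm (p - q) * (1 / (1 - r))"
        by (rule order_trans[OF norm_mult_ineq mult_left_mono]) (use lq in auto)
    qed simp
    also have "\<dots> = (\<bar>a\<bar> * (3 / (1 - r))) * norm (p - q)" by (simp add: algebra_simps add_divide_distrib[symmetric])
    finally show ?thesis .
  qed
  then show ?thesis using r by (intro exI[of _ "1 - r"] conjI exI[of _ "\<bar>a\<bar> * (3 / (1 - r))"]) auto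
qed

lemma matrix_inv_inverse:
  assumes "invertible A"
  shows "A ** matrix_inv A = mat 1" "matrix_inv A ** A = mat 1"
  using someI_ex[OF assms[unfolded invertible_def]] by (simp_all add: matrix_inv_def)

lemma matrix_inv_sqm:
  assumes "invertible A"
  shows "sqm A * sqm (matrix_inv A) = 1" "sqm (matrix_inv A) * sqm A = 1"
  using assms by (simp_all add: sqm_simps(5)[symmetric] matrix_inv_inverse sqm_simps)

lemma solution_invertible:
  "linear_lie_group G \<Longrightarrow> system_solution G u X \<Longrightarrow> invertible (X t)"
  unfolding linear_lie_group_def system_solution_def by blast

lemma forward_interval_subset:
  "t \<in> forward_interval t0 T \<Longrightarrow> {t0..t} \<subseteq> forward_interval t0 T"
  by (auto simp: forward_interval_def intro: le_less_trans[rotated])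

text \<open>With $E = X^{-1}\hat X$ the terms involving $u$ cancel, and the error obeys the autonomous
  equation $\dot E = -aE\log E$.\<close>

theorem error_dynamics:
  assumes G: "linear_lie_group G" and X: "system_solution G u X"
    and obs: "observer_solution a u X t0 T Xh" and t: "t \<in> forward_interval t0 T"
  shows "((\<lambda>t. sqm (left_error X Xh t)) has_vector_derivative
    error_field a (sqm (left_error X Xh t))) (at t within forward_interval t0 T)"
proof -
  let ?J = "forward_interval t0 T"
  let ?x = "\<lambda>t. sqm (X t)" and ?z = "\<lambda>t. sqm (matrix_inv (X t))" and ?h = "\<lambda>t. sqm (Xh t)"
  note inv = matrix_inv_sqm[OF solution_invertible[OF G X]]
  define l where "l = sqm (matrix_log (matrix_inv (X t) ** Xh t))"
  have "(X has_vector_derivative X t ** u t) (at t within ?J)"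
    using X by (auto simp: system_solution_def intro: has_vector_derivative_at_within)
  from bounded_linear.has_vector_derivative[OF bounded_linear_sqm this]
  have x': "(?x has_vector_derivative ?x t * sqm (u t)) (at t within ?J)" by (simp add: sqm_simps)
  have z': "(?z has_vector_derivative - (?z t * (?x t * sqm (u t)) * ?z t)) (at t within ?J)"
    by (rule has_vector_derivative_algebra_inverse[OF _ t x']) (simp add: inv)
  have "(Xh has_vector_derivative X t ** u t ** matrix_inv (X t) ** Xh t
      - a *\<^sub>R (Xh t ** matrix_log (matrix_inv (X t) ** Xh t))) (at t within ?J)"
    using obs t by (auto simp: observer_solution_def)
  from bounded_linear.has_vector_derivative[OF bounded_linear_sqm this]
  have h': "(?h has_vector_derivative ?x t * sqm (u t) * ?z t * ?h t - a *\<^sub>R (?h t * l)) (at t within ?J)"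
    by (simp add: sqm_simps l_def)
  have "((\<lambda>t. ?z t * ?h t) has_vector_derivative
      ?z t * (?x t * sqm (u t) * ?z t * ?h t - a *\<^sub>R (?h t * l))
      + - (?z t * (?x t * sqm (u t)) * ?z t) * ?h t) (at t within ?J)"
    by (rule has_vector_derivative_mult[OF z' h'])
  moreover have "?z t * (?x t * sqm (u t) * ?z t * ?h t - a *\<^sub>R (?h t * l))
      + - (?z t * (?x t * sqm (u t)) * ?z t) * ?h t = - a *\<^sub>R (?z t * ?h t * l)"
    by (simp add: algebra_simps)
  ultimately show ?thesis
    by (simp add: left_error_def error_field_def sqm_simps mat_of_simps l_def)
qed

lemma observer_solution_unique:
  assumes G: "linear_lie_group G" and X: "system_solution G u X" and a: "0 < a"
    and obs: "observer_solution a u X t0 T Xh" and t: "t \<in> forward_interval t0 T"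
    and init: "matrix_norm (left_error X Xh t0 - mat 1) < 1"
  shows "sqm (left_error X Xh t) = error_flow a t0 (sqm (left_error X Xh t0)) t"
proof -
  let ?E = "\<lambda>t. sqm (left_error X Xh t)"
  have E0: "norm (?E t0 - 1) < 1" using init by (simp add: matrix_norm_eq sqm_simps)
  have tt: "t \<in> {t0..t}" using t by (simp add: forward_interval_def)
  show ?thesis
  proof (rule locally_lipschitz_ode_unique[OF _ _ _ _ tt, where f = "error_field a"])
    fix s assume s: "s \<in> {t0..t}"
    then have J: "s \<in> forward_interval t0 T" using forward_interval_subset[OF t] by blast
    have ball: "norm (error_flow a t0 (?E t0) s - 1) < 1"
      using s by (intro error_flow_bounds(1)[OF E0 _ a]) simp
    show "(?E has_vector_derivative error_field a (?E s)) (at s within {t0..t})"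
      by (rule has_vector_derivative_within_subset[OF error_dynamics[OF G X obs J] forward_interval_subset[OF t]])
    show "(error_flow a t0 (?E t0) has_vector_derivative
        error_field a (error_flow a t0 (?E t0) s)) (at s within {t0..t})"
      unfolding error_field_unit_ball[OF ball]
      using s by (intro error_flow_has_vector_derivative[OF E0 _ a]) simp
    show "\<exists>e>0. \<exists>C. \<forall>p\<in>ball (error_flow a t0 (?E t0) s) e. \<forall>q\<in>ball (error_flow a t0 (?E t0) s) e.
        norm (error_field a p - error_field a q) \<le> C * norm (p - q)"
      by (rule error_field_locally_lipschitz[OF ball])
  next
    show "?E t0 = error_flow a t0 (?E t0) t0" using error_flow_init[OF E0] by simp
  qed
qed

lemma observer_solution_flow:
  assumes G: "linear_lie_group G" and X: "system_solution G u X" and a: "0 < a"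
    and E0: "norm (E0 - 1) < 1"
  shows "observer_solution a u X t0 \<infinity> (\<lambda>t. X t ** mat_of (error_flow a t0 E0 t))"
  unfolding observer_solution_def
proof (intro conjI ballI)
  fix t assume t: "t \<in> forward_interval t0 \<infinity>"
  let ?J = "forward_interval t0 \<infinity>"
  let ?F = "error_flow a t0 E0"
  have t0: "t0 \<le> t" using t by (simp add: forward_interval_def)
  note inv = matrix_inv_sqm[OF solution_invertible[OF G X, of t]]
  have err: "matrix_inv (X t) ** (X t ** mat_of (?F t)) = mat_of (?F t)"
    using solution_invertible[OF G X, of t] by (simp add: matrix_mul_assoc matrix_inv_inverse)
  have ball: "norm (sqm (mat_of (?F t)) - 1) < 1" using error_flow_bounds(1)[OF E0 t0 a] by simp
  show "matrix_inv (X t) ** (X t ** mat_of (?F t)) \<in> log_domain"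
    unfolding err by (rule log_domain_unit_ball[OF ball])
  have "(X has_vector_derivative X t ** u t) (at t within ?J)"
    using X by (auto simp: system_solution_def intro: has_vector_derivative_at_within)
  from bounded_linear.has_vector_derivative[OF bounded_linear_sqm this]
  have x': "((\<lambda>t. sqm (X t)) has_vector_derivative sqm (X t) * sqm (u t)) (at t within ?J)"
    by (simp add: sqm_simps)
  let ?D = "sqm (X t) * (- a *\<^sub>R (?F t * log_series (?F t - 1))) + sqm (X t) * sqm (u t) * ?F t"
  have "((\<lambda>t. sqm (X t) * ?F t) has_vector_derivative ?D) (at t within ?J)"
    by (rule has_vector_derivative_mult[OF x' error_flow_has_vector_derivative[OF E0 t0 a]])
  from bounded_linear.has_vector_derivative[OF bounded_linear_mat_of this]
  have "((\<lambda>t. X t ** mat_of (?F t)) has_vector_derivative mat_of ?D) (at t within ?J)"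
    by (simp add: mat_of_simps)
  moreover have "mat_of ?D = X t ** u t ** matrix_inv (X t) ** (X t ** mat_of (?F t))
      - a *\<^sub>R (X t ** mat_of (?F t) ** matrix_log (matrix_inv (X t) ** (X t ** mat_of (?F t))))"
  proof -
    have "?D = sqm (X t) * sqm (u t) * sqm (matrix_inv (X t)) * (sqm (X t) * ?F t)
        - a *\<^sub>R (sqm (X t) * ?F t * log_series (?F t - 1))"
      using inv(2) by (simp add: mult.assoc) (simp add: mult.assoc[symmetric])
    then show ?thesis
      unfolding err matrix_log_eq[OF ball] by (simp add: mat_of_simps)
  qed
  ultimately show "((\<lambda>t. X t ** mat_of (?F t)) has_vector_derivative
      X t ** u t ** matrix_inv (X t) ** (X t ** mat_of (?F t))
      - a *\<^sub>R (X t ** mat_of (?F t) ** matrix_log (matrix_inv (X t) ** (X t ** mat_of (?F t)))))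
      (at t within ?J)" by simp
qed simp

section \<open>Stability of the observer\<close>

text \<open>The explicit solution exists for all time. By uniqueness it extends every other solution
  with the same initial value, so a maximal solution cannot stop at a finite time.\<close>

lemma maximal_observer_solution_from_unit_ball:
  assumes G: "linear_lie_group G" and X: "system_solution G u X" and a: "0 < a"
    and init: "matrix_norm (matrix_inv (X t0) ** Xh0 - mat 1) < 1"
  shows "\<exists>T Xh. maximal_observer_solution a u X t0 T Xh \<and> Xh t0 = Xh0"
    and "\<And>T Xh. maximal_observer_solution a u X t0 T Xh \<Longrightarrow> Xh t0 = Xh0 \<Longrightarrow>
      T = \<infinity> \<and> (\<forall>t\<ge>t0.
        sqm (left_error X Xh t) = error_flow a t0 (sqm (matrix_inv (X t0) ** Xh0)) t)"
proof -
  let ?E0 = "sqm (matrix_inv (X t0) ** Xh0)"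
  define R where "R t = X t ** mat_of (error_flow a t0 ?E0 t)" for t
  have E0: "norm (?E0 - 1) < 1" using init by (simp add: matrix_norm_eq sqm_simps)
  have R: "observer_solution a u X t0 \<infinity> R"
    unfolding R_def by (rule observer_solution_flow[OF G X a E0])
  have cancel: "X t ** (matrix_inv (X t) ** A) = A" for t A
    using solution_invertible[OF G X, of t] by (simp add: matrix_mul_assoc matrix_inv_inverse)
  have R0: "R t0 = Xh0" by (simp add: R_def error_flow_init[OF E0] cancel)
  show "\<exists>T Xh. maximal_observer_solution a u X t0 T Xh \<and> Xh t0 = Xh0"
    using R R0 unfolding maximal_observer_solution_def
    by (intro exI[of _ \<infinity>] exI[of _ R]) auto
  fix T Xh assume max: "maximal_observer_solution a u X t0 T Xh" and Xh0: "Xh t0 = Xh0"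
  have obs: "observer_solution a u X t0 T Xh" using max by (simp add: maximal_observer_solution_def)
  have left0: "left_error X Xh t0 = matrix_inv (X t0) ** Xh0" by (simp add: left_error_def Xh0)
  have flow: "sqm (left_error X Xh t) = error_flow a t0 ?E0 t" if "t \<in> forward_interval t0 T" for t
    using observer_solution_unique[OF G X a obs that] init unfolding left0 by simp
  have agree: "R t = Xh t" if "t \<in> forward_interval t0 T" for t
    unfolding R_def flow[OF that, symmetric] by (simp add: left_error_def cancel)
  have "T = \<infinity>"
  proof (rule ccontr)
    assume "T \<noteq> \<infinity>"
    then have "T < \<infinity>" by (simp add: less_top[symmetric] top_ereal_def)
    with R agree max show False unfolding maximal_observer_solution_def by blast
  qed
  then show "T = \<infinity> \<and> (\<forall>t\<ge>t0. sqm (left_error X Xh t) = error_flow a t0 ?E0 t)"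
    using flow by (simp add: forward_interval_def)
qed

lemma flow_error_bound:
  assumes "0 < a" "t0 \<le> t" "matrix_norm (E0 - mat 1) < 1"
    and "sqm E = error_flow a t0 (sqm E0) t"
  shows "matrix_norm (E - mat 1) \<le> - ln (1 - matrix_norm (E0 - mat 1)) * exp (- a * (t - t0))"
proof -
  have "norm (sqm E0 - 1) < 1" using assms(3) by (simp add: matrix_norm_eq sqm_simps)
  from error_flow_bounds(2)[OF this assms(2,1)] show ?thesis
    by (simp add: matrix_norm_eq sqm_simps assms(4))
qed

lemma matrix_log_mat_1: "matrix_log (mat 1) = 0"
  using matrix_log_eq[of "mat 1"] by (simp add: sqm_simps mat_of_simps)

text \<open>If the error is constantly $1$, then $\hat X = X$ on the interval, and $\log 1 = 0$.\<close>

lemma error_equilibrium_identity: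
  assumes G: "linear_lie_group G"
  shows "error_equilibrium G a u"
  unfolding error_equilibrium_def observer_solution_def
proof (intro allI impI conjI ballI)
  fix X t0 Xh t
  assume X: "system_solution G u X" and E: "\<forall>t\<ge>t0. left_error X Xh t = mat 1"
    and t: "t \<in> forward_interval t0 \<infinity>"
  have t0: "t0 \<le> t" using t by (simp add: forward_interval_def)
  have Xh: "Xh s = X s" if "t0 \<le> s" for s
  proof -
    have "X s ** (matrix_inv (X s) ** Xh s) = X s ** mat 1"
      using E that by (simp add: left_error_def)
    then show ?thesis
      using solution_invertible[OF G X, of s] by (simp add: matrix_mul_assoc matrix_inv_inverse)
  qed
  have id: "matrix_inv (X t) ** Xh t = mat 1" using E t0 by (simp add: left_error_def)
  show "matrix_inv (X t) ** Xh t \<in> log_domain"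
    unfolding id by (rule log_domain_unit_ball) (simp add: sqm_simps)
  have "(X has_vector_derivative X t ** u t) (at t within forward_interval t0 \<infinity>)"
    using X by (auto simp: system_solution_def intro: has_vector_derivative_at_within)
  then have "(Xh has_vector_derivative X t ** u t) (at t within forward_interval t0 \<infinity>)"
    by (rule has_vector_derivative_transform[OF t, rotated])
      (simp add: forward_interval_def Xh)
  moreover have "X t ** u t ** matrix_inv (X t) ** Xh t
      - a *\<^sub>R (Xh t ** matrix_log (matrix_inv (X t) ** Xh t)) = X t ** u t"
    unfolding matrix_mul_assoc[symmetric] id matrix_log_mat_1 by simp
  ultimately show "(Xh has_vector_derivative X t ** u t ** matrix_inv (X t) ** Xh t
      - a *\<^sub>R (Xh t ** matrix_log (matrix_inv (X t) ** Xh t))) (at t within forward_interval t0 \<infinity>)"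
    by (simp only:)
qed simp

lemma minus_ln_one_minus_le:
  fixes r :: real
  assumes "0 \<le> r" "r \<le> 1 / 2"
  shows "- ln (1 - r) \<le> 2 * r"
proof -
  have "r * r \<le> r * (1 / 2)" using assms by (intro mult_left_mono) auto
  then show ?thesis
    using ln_one_minus_pos_lower_bound[OF assms] by (simp add: power2_eq_square)
qed

lemma error_locally_exponentially_stable:
  assumes G: "linear_lie_group G" and a: "0 < a"
  shows "error_locally_exponentially_stable G a u"
  unfolding error_locally_exponentially_stable_def
proof (rule exI[of _ "1 / 2 :: real"], rule conjI, simp, rule exI[of _ "2 :: real"], rule conjI, simp,
    rule exI[of _ a], rule conjI, rule a, intro allI impI)
  fix X t0 Xh0
  assume X: "system_solution G u X" and init: "matrix_norm (matrix_inv (X t0) ** Xh0 - mat 1) < 1 / 2"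
  then have init1: "matrix_norm (matrix_inv (X t0) ** Xh0 - mat 1) < 1" by simp
  note max = maximal_observer_solution_from_unit_ball[OF G X a init1]
  have "T = \<infinity> \<and> (\<forall>t\<ge>t0. matrix_norm (left_error X Xh t - mat 1)
      \<le> 2 * exp (- a * (t - t0)) * matrix_norm (left_error X Xh t0 - mat 1))"
    if sol: "maximal_observer_solution a u X t0 T Xh" "Xh t0 = Xh0" for T Xh
  proof (intro conjI allI impI)
    show "T = \<infinity>" using max(2)[OF sol] by simp
    fix t assume t: "t0 \<le> t"
    let ?r = "matrix_norm (matrix_inv (X t0) ** Xh0 - mat 1)"
    have "matrix_norm (left_error X Xh t - mat 1) \<le> - ln (1 - ?r) * exp (- a * (t - t0))"
      using max(2)[OF sol] t by (intro flow_error_bound[OF a t init1]) simp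
    also have "\<dots> \<le> 2 * ?r * exp (- a * (t - t0))"
      using init by (intro mult_right_mono minus_ln_one_minus_le) (auto simp: matrix_norm_eq)
    finally show "matrix_norm (left_error X Xh t - mat 1)
        \<le> 2 * exp (- a * (t - t0)) * matrix_norm (left_error X Xh t0 - mat 1)"
      by (simp add: left_error_def sol(2) mult_ac)
  qed
  with max(1) show "(\<exists>T Xh. maximal_observer_solution a u X t0 T Xh \<and> Xh t0 = Xh0) \<and>
      (\<forall>T Xh. maximal_observer_solution a u X t0 T Xh \<longrightarrow> Xh t0 = Xh0 \<longrightarrow> T = \<infinity> \<and>
        (\<forall>t\<ge>t0. matrix_norm (left_error X Xh t - mat 1)
          \<le> 2 * exp (- a * (t - t0)) * matrix_norm (left_error X Xh t0 - mat 1)))"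
    by blast
qed

lemma minus_ln_one_minus_nonneg: "0 \<le> r \<Longrightarrow> r < 1 \<Longrightarrow> 0 \<le> - ln (1 - r :: real)"
  by simp

lemma error_converges_from_unit_ball:
  assumes G: "linear_lie_group G" and a: "0 < a"
  shows "error_converges_from_unit_ball G a u"
  unfolding error_converges_from_unit_ball_def
proof (intro allI impI)
  fix X Xh0
  assume X: "system_solution G u X" and init: "matrix_norm (matrix_inv (X 0) ** Xh0 - mat 1) < 1"
  note max = maximal_observer_solution_from_unit_ball[OF G X a init]
  let ?l = "- ln (1 - matrix_norm (matrix_inv (X 0) ** Xh0 - mat 1))"
  have l: "0 \<le> ?l" using init by (intro minus_ln_one_minus_nonneg) (auto simp: matrix_norm_eq)
  have "T = \<infinity> \<and> converges_exponentially (left_error X Xh) (\<lambda>_. mat 1)"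
    if sol: "maximal_observer_solution a u X 0 T Xh" "Xh 0 = Xh0" for T Xh
  proof
    show "T = \<infinity>" using max(2)[OF sol] by simp
    have "matrix_norm (left_error X Xh t - mat 1) \<le> (?l + 1) * exp (- a * t)" if t: "0 \<le> t" for t
    proof -
      have "matrix_norm (left_error X Xh t - mat 1) \<le> ?l * exp (- a * (t - 0))"
        using max(2)[OF sol] t by (intro flow_error_bound[OF a t init]) simp
      also have "\<dots> \<le> (?l + 1) * exp (- a * t)" by (simp add: algebra_simps)
      finally show ?thesis .
    qed
    moreover have "0 < ?l + 1" using l by linarith
    ultimately show "converges_exponentially (left_error X Xh) (\<lambda>_. mat 1)"
      unfolding converges_exponentially_def using a by blast
  qed
  with max(1) show "(\<exists>T Xh. maximal_observer_solution a u X 0 T Xh \<and> Xh 0 = Xh0) \<and>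
      (\<forall>T Xh. maximal_observer_solution a u X 0 T Xh \<longrightarrow> Xh 0 = Xh0 \<longrightarrow>
        T = \<infinity> \<and> converges_exponentially (left_error X Xh) (\<lambda>_. mat 1))"
    by blast
qed

lemma closed_unit_subgroup_sqm:
  fixes G :: "(real^'n^'n) set"
  assumes G: "linear_lie_group G"
  shows "closed_unit_subgroup (sqm ` G)"
proof
  show "1 \<in> sqm ` G" using G by (metis imageI linear_lie_group_def sqm_simps(2))
  show "g * h \<in> sqm ` G" if "g \<in> sqm ` G" "h \<in> sqm ` G" for g h
    using that G unfolding linear_lie_group_def by (force simp: sqm_simps(5)[symmetric])
  show "\<exists>h\<in>sqm ` G. g * h = 1 \<and> h * g = 1" if g: "g \<in> sqm ` G" for g
  proof -
    obtain A where A: "A \<in> G" "g = sqm A" using g by blast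
    then have "invertible A" "matrix_inv A \<in> G" using G unfolding linear_lie_group_def by blast+
    with A matrix_inv_sqm[of A] show ?thesis by blast
  qed
  fix f :: "nat \<Rightarrow> 'n sqmat" and x y
  assume f: "\<And>k. f k \<in> sqm ` G" and lim: "f \<longlonglongrightarrow> x" and xy: "x * y = 1" "y * x = 1"
  obtain C where C: "closed C" "G = {A. invertible A} \<inter> C"
    using G unfolding linear_lie_group_def closedin_closed by blast
  have "mat_of (f k) \<in> C" for k using f[of k] C(2) by auto
  then have "mat_of x \<in> C"
    by (rule closed_sequentially[OF C(1) _ bounded_linear.tendsto[OF bounded_linear_mat_of lim]])
  moreover have "invertible (mat_of x)"
    unfolding invertible_def
    using xy by (intro exI[of _ "mat_of y"]) (simp add: mat_of_simps[symmetric])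
  ultimately have "mat_of x \<in> G" using C(2) by blast
  then show "x \<in> sqm ` G" by (metis imageI mat_of_inverse)
qed

text \<open>Cartan's theorem turns the initial error into $\exp L$ with $L$ in the Lie algebra, and the
  error then stays on the one-parameter subgroup generated by $L$.\<close>

lemma error_flow_mem_group:
  fixes G :: "(real^'n^'n) set"
  assumes G: "linear_lie_group G"
  obtains \<rho> where "0 < \<rho>" "\<rho> < 1"
    "\<And>E0 a t0 t. E0 \<in> G \<Longrightarrow> matrix_norm (E0 - mat 1) < \<rho> \<Longrightarrow> mat_of (error_flow a t0 (sqm E0) t) \<in> G"
proof -
  interpret closed_unit_subgroup "sqm ` G" by (rule closed_unit_subgroup_sqm[OF G])
  obtain \<rho> where \<rho>: "0 < \<rho>" "\<rho> < 1"
    "\<And>g. g \<in> sqm ` G \<Longrightarrow> norm (g - 1) < \<rho> \<Longrightarrow> log_series (g - 1) \<in> generators"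
    using log_series_mem_generators by blast
  have "mat_of (error_flow a t0 (sqm E0) t) \<in> G"
    if "E0 \<in> G" "matrix_norm (E0 - mat 1) < \<rho>" for E0 a t0 t
  proof -
    have "log_series (sqm E0 - 1) \<in> generators"
      using that by (intro \<rho>(3)) (auto simp: matrix_norm_eq sqm_simps)
    then have "error_flow a t0 (sqm E0) t \<in> sqm ` G"
      unfolding error_flow_def by (intro exp_mem scaleR_mem_generators)
    then show ?thesis by auto
  qed
  with \<rho>(1,2) that show thesis by blast
qed

lemma observer_stays_in_group_and_converges:
  assumes G: "linear_lie_group G" and X: "system_solution G u X" and a: "0 < a"
    and bd: "bounded (X ` {0..})"
  shows "\<exists>\<epsilon>>0. \<forall>Xh0\<in>G. matrix_norm (Xh0 - X 0) < \<epsilon> \<longrightarrow>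
    (\<exists>T Xh. maximal_observer_solution a u X 0 T Xh \<and> Xh 0 = Xh0) \<and>
    (\<forall>T Xh. maximal_observer_solution a u X 0 T Xh \<longrightarrow> Xh 0 = Xh0 \<longrightarrow>
      T = \<infinity> \<and> (\<forall>t\<ge>0. Xh t \<in> G) \<and> converges_exponentially Xh X)"
proof -
  obtain \<rho> where \<rho>: "0 < \<rho>" "\<rho> < 1"
    "\<And>E0 a t0 t. E0 \<in> G \<Longrightarrow> matrix_norm (E0 - mat 1) < \<rho> \<Longrightarrow> mat_of (error_flow a t0 (sqm E0) t) \<in> G"
    using error_flow_mem_group[OF G] by blast
  have XG: "X t \<in> G" for t using X by (simp add: system_solution_def)
  have mult: "A ** B \<in> G" if "A \<in> G" "B \<in> G" for A B
    using G that unfolding linear_lie_group_def by blast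
  have inv: "invertible (X t)" for t by (rule solution_invertible[OF G X])
  obtain B where B: "0 < B" "\<And>t. 0 \<le> t \<Longrightarrow> norm (sqm (X t)) \<le> B"
    using bounded_linear_image[OF bd bounded_linear_sqm] unfolding bounded_pos by auto
  define K where "K = norm (sqm (matrix_inv (X 0))) + 1"
  have K: "0 < K" "norm (sqm (matrix_inv (X 0))) \<le> K" by (auto simp: K_def add_nonneg_pos)
  show ?thesis
  proof (intro exI[of _ "\<rho> / K"] conjI ballI impI)
    show "0 < \<rho> / K" using \<rho>(1) K(1) by simp
    fix Xh0 assume Xh0: "Xh0 \<in> G" "matrix_norm (Xh0 - X 0) < \<rho> / K"
    let ?E0 = "matrix_inv (X 0) ** Xh0"
    have "sqm ?E0 - 1 = sqm (matrix_inv (X 0)) * sqm (Xh0 - X 0)"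
      using matrix_inv_sqm[OF inv[of 0]] by (simp add: sqm_simps algebra_simps)
    then have "norm (sqm ?E0 - 1) \<le> norm (sqm (matrix_inv (X 0))) * norm (sqm (Xh0 - X 0))"
      by (simp add: norm_mult_ineq)
    also have "\<dots> \<le> K * norm (sqm (Xh0 - X 0))" by (intro mult_right_mono K) simp
    also have "\<dots> < \<rho>"
      using Xh0(2) K(1) by (simp add: matrix_norm_eq pos_less_divide_eq mult.commute)
    finally have small: "matrix_norm (?E0 - mat 1) < \<rho>" by (simp add: matrix_norm_eq sqm_simps)
    then have init: "matrix_norm (?E0 - mat 1) < 1" using \<rho>(2) by simp
    have E0: "?E0 \<in> G" using G XG Xh0(1) mult unfolding linear_lie_group_def by blast
    note max = maximal_observer_solution_from_unit_ball[OF G X a init]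
    show "\<exists>T Xh. maximal_observer_solution a u X 0 T Xh \<and> Xh 0 = Xh0" by (rule max(1))
    show "\<forall>T Xh. maximal_observer_solution a u X 0 T Xh \<longrightarrow> Xh 0 = Xh0 \<longrightarrow>
      T = \<infinity> \<and> (\<forall>t\<ge>0. Xh t \<in> G) \<and> converges_exponentially Xh X"
    proof (intro allI impI)
      fix T Xh
      assume sol: "maximal_observer_solution a u X 0 T Xh" "Xh 0 = Xh0"
      have flow: "sqm (left_error X Xh t) = error_flow a 0 (sqm ?E0) t" if "0 \<le> t" for t
        using max(2)[OF sol] that by blast
      have Xh: "Xh t = X t ** left_error X Xh t" for t
        using inv[of t] by (simp add: left_error_def matrix_mul_assoc matrix_inv_inverse)
      have "Xh t \<in> G" if t: "0 \<le> t" for t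
      proof -
        have "mat_of (sqm (left_error X Xh t)) \<in> G" unfolding flow[OF t] by (rule \<rho>(3)[OF E0 small])
        then show ?thesis using mult[OF XG[of t]] Xh[of t] by simp
      qed
      moreover have "converges_exponentially Xh X"
      proof -
        let ?l = "- ln (1 - matrix_norm (?E0 - mat 1))"
        have l: "0 \<le> ?l" using init by (intro minus_ln_one_minus_nonneg) (auto simp: matrix_norm_eq)
        have "matrix_norm (Xh t - X t) \<le> (B * ?l + 1) * exp (- a * t)" if t: "0 \<le> t" for t
        proof -
          have "sqm (Xh t - X t) = sqm (X t) * sqm (left_error X Xh t - mat 1)"
            by (subst Xh) (simp add: sqm_simps algebra_simps)
          then have "matrix_norm (Xh t - X t) \<le> norm (sqm (X t)) * matrix_norm (left_error X Xh t - mat 1)"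
            by (simp add: matrix_norm_eq norm_mult_ineq)
          also have "\<dots> \<le> B * (?l * exp (- a * (t - 0)))"
            using B t flow[OF t]
            by (intro mult_mono flow_error_bound[OF a t init]) (auto simp: matrix_norm_eq)
          also have "\<dots> \<le> (B * ?l + 1) * exp (- a * t)" by (simp add: algebra_simps)
          finally show ?thesis .
        qed
        moreover have "0 < B * ?l + 1" using mult_nonneg_nonneg[OF less_imp_le[OF B(1)] l] by linarith
        ultimately show ?thesis unfolding converges_exponentially_def using a by blast
      qed
      ultimately show "T = \<infinity> \<and> (\<forall>t\<ge>0. Xh t \<in> G) \<and> converges_exponentially Xh X"
        using max(2)[OF sol] by blast
    qed
  qed
qed

theorem mainTheorem2:
  fixes G :: "(real^'n^'n) set" and u :: "real \<Rightarrow> real^'n^'n" and a0 :: real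
  assumes "linear_lie_group G"
    and "\<forall>t. u t \<in> lie_algebra G"
    and "admissible_input G u"
    and "a0 > 0"
  shows "observer_exponentially_stabilizes G a0 u \<and>
    ((\<forall>X. system_solution G u X \<longrightarrow> bounded (X ` {0..})) \<longrightarrow>
      (\<forall>X. system_solution G u X \<longrightarrow>
        (\<exists>\<epsilon>>0. \<forall>Xh0\<in>G. matrix_norm (Xh0 - X 0) < \<epsilon> \<longrightarrow>
          (\<exists>T Xh. maximal_observer_solution a0 u X 0 T Xh \<and> Xh 0 = Xh0) \<and>
          (\<forall>T Xh. maximal_observer_solution a0 u X 0 T Xh \<longrightarrow> Xh 0 = Xh0 \<longrightarrow>
            T = \<infinity> \<and> (\<forall>t\<ge>0. Xh t \<in> G) \<and> converges_exponentially Xh X))))"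
proof (rule conjI)
  show "observer_exponentially_stabilizes G a0 u"
    unfolding observer_exponentially_stabilizes_def
    using error_equilibrium_identity error_locally_exponentially_stable
      error_converges_from_unit_ball assms(1,4) by blast
  show "(\<forall>X. system_solution G u X \<longrightarrow> bounded (X ` {0..})) \<longrightarrow>
      (\<forall>X. system_solution G u X \<longrightarrow>
        (\<exists>\<epsilon>>0. \<forall>Xh0\<in>G. matrix_norm (Xh0 - X 0) < \<epsilon> \<longrightarrow>
          (\<exists>T Xh. maximal_observer_solution a0 u X 0 T Xh \<and> Xh 0 = Xh0) \<and>
          (\<forall>T Xh. maximal_observer_solution a0 u X 0 T Xh \<longrightarrow> Xh 0 = Xh0 \<longrightarrow>
            T = \<infinity> \<and> (\<forall>t\<ge>0. Xh t \<in> G) \<and> converges_exponentially Xh X)))"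
    using observer_stays_in_group_and_converges[OF assms(1) _ assms(4)] by blast
qed

end
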